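(* Let $X$ be a bounded geometry metric space and let $G(X)$ be the associated coarse groupoid. Then there is a canonical isomorphism $$H_*(G(X))\cong H_*^{\mathrm{uf}}(X)$$ between the groupoid homology of the coarse groupoid and the uniformly finite homology of $X$.
   Context: A metric space $X$ has bounded geometry if for each $r>0$ there is a uniform bound on the cardinalities of all $r$-balls in $X$. Coarse groupoid: let $\beta X$ be the Stone–Čech compactification of the (discrete) set $X$, and for $r>0$ let $E_r$ be the closure of $\{(x,y)\in X\times X\mid d(x,y)\le r\}$ in $\beta X\times\beta X$. The coarse groupoid is the set $G(X)=\bigcup_{r}E_r$ with the restriction of the pair groupoid operations from $\beta X\times\beta X$ and the topology in which $U$ is open iff $U\cap E_r$ is open in $E_r$ for every $r$. It is a principal, ample, $\sigma$-compact, locally compact Hausdorff étale groupoid with compact base space $\beta X$. Uniformly finite homology: $C_n(X)$ is the group of bounded functions $c:X^{n+1}\to\mathbb{Z}$ for which there is $r>0$ such that $c(x_0,\dots,x_n)\ne0$ implies that $\{x_0,\dots,x_n\}$ has diameter at most $r$. With $\partial^i(x_0,\dots,x_n)=(x_0,\dots,\widehat{x_i},\dots,x_n)$ (omit $x_i$), put $(\partial^i_*c)(x)=\sum_{\partial^iy=x}c(y)$ and $\partial=\sum_{i=0}^n(-1)^i\partial^i_*:C_n(X)\to C_{n-1}(X)$. $H^{\mathrm{uf}}_*(X)$ is the homology of this chain complex. Groupoid homology of an ample groupoid $G$ with base space $G^0$, range $r$ and source $s$: for a locally compact Hausdorff totally disconnected space $Y$ let $\mathbb{Z}[Y]=C_c(Y,\mathbb{Z})$;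 a local homeomorphism $f:Y\to Z$ induces $f_*:\mathbb{Z}[Y]\to\mathbb{Z}[Z]$, $f_*(a)(z)=\sum_{y\in f^{-1}(z)}a(y)$. Let $G^{(0)}=G^0$ and, for $n\ge 1$, $G^{(n)}=\{(g_1,\dots,g_n)\in G^n\mid s(g_i)=r(g_{i+1})\text{ for }1\le i<n\}$. The face maps $\epsilon^n_i:G^{(n)}\to G^{(n-1)}$, $0\le i\le n$, are, for $n\ge2$: $\epsilon^n_0(g_1,\dots,g_n)=(g_2,\dots,g_n)$, $\epsilon^n_i(g_1,\dots,g_n)=(g_1,\dots,g_ig_{i+1},\dots,g_n)$ for $0<i<n$, $\epsilon^n_n(g_1,\dots,g_n)=(g_1,\dots,g_{n-1})$; and $\epsilon^1_0=s$, $\epsilon^1_1=r$. $H_*(G)$ is the homology of $(\mathbb{Z}[G^{( * )}],\partial_* )$ with $\partial_n=\sum_{i=0}^n(-1)^i(\epsilon^n_i)_*$. *)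

theory Defs
  imports "HOL-Analysis.Analysis" "HOL-Algebra.Coset"
begin

section \<open>Homology of a non-negatively graded complex\<close>

text \<open>
  A complex is a family of abelian groups \<open>C n\<close>, written multiplicatively as in HOL-Algebra,
  with maps \<open>D n : C n \<rightarrow> C (n - 1)\<close> for \<open>n \<ge> 1\<close>. The complex is extended by zero in negative
  degrees, so \<open>D 0\<close> is never used and every element of \<open>C 0\<close> is a cycle.
\<close>

definition cycles :: "(nat \<Rightarrow> 'c monoid) \<Rightarrow> (nat \<Rightarrow> 'c \<Rightarrow> 'c) \<Rightarrow> nat \<Rightarrow> 'c set" where
  "cycles C D n = (if n = 0 then carrier (C 0) else kernel (C n) (C (n - 1)) (D n))"

definition boundaries :: "(nat \<Rightarrow> 'c monoid) \<Rightarrow> (nat \<Rightarrow> 'c \<Rightarrow> 'c) \<Rightarrow> nat \<Rightarrow> 'c set" where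
  "boundaries C D n = D (Suc n) ` carrier (C (Suc n))"

definition homology :: "(nat \<Rightarrow> 'c monoid) \<Rightarrow> (nat \<Rightarrow> 'c \<Rightarrow> 'c) \<Rightarrow> nat \<Rightarrow> 'c set monoid" where
  "homology C D n = (C n)\<lparr>carrier := cycles C D n\<rparr> Mod boundaries C D n"

definition homology_class ::
    "(nat \<Rightarrow> 'c monoid) \<Rightarrow> (nat \<Rightarrow> 'c \<Rightarrow> 'c) \<Rightarrow> nat \<Rightarrow> 'c \<Rightarrow> 'c set" where
  "homology_class C D n z = boundaries C D n #>\<^bsub>C n\<^esub> z"

lemma homology_class_in_homology:
  assumes "z \<in> cycles C D n"
  shows "homology_class C D n z \<in> carrier (homology C D n)"
  using assms
  by (auto simp: homology_class_def homology_def FactGroup_def RCOSETS_def r_coset_def)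

definition int_fun_group :: "('x \<Rightarrow> int) set \<Rightarrow> ('x \<Rightarrow> int) monoid" where
  "int_fun_group S = \<lparr>carrier = S, mult = (\<lambda>a b x. a x + b x), one = (\<lambda>_. 0)\<rparr>"

text \<open>
  The pushforward sums over the nonzero values of \<open>a\<close> in each fibre only. In both complexes
  below there are finitely many of them; \<open>sum\<close> over the whole, possibly infinite, fibre
  would be \<open>0\<close>.
\<close>

definition pushforward :: "'y set \<Rightarrow> ('y \<Rightarrow> 'z) \<Rightarrow> ('y \<Rightarrow> int) \<Rightarrow> 'z \<Rightarrow> int" where
  "pushforward S f a z = (\<Sum>y | y \<in> S \<and> f y = z \<and> a y \<noteq> 0. a y)"

definition alternating_pushforward ::
    "nat \<Rightarrow> 'y set \<Rightarrow> (nat \<Rightarrow> 'y \<Rightarrow> 'z) \<Rightarrow> ('y \<Rightarrow> int) \<Rightarrow> 'z \<Rightarrow> int" where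
  "alternating_pushforward n S f a z = (\<Sum>i\<le>n. (-1) ^ i * pushforward S (f i) a z)"


section \<open>Bounded geometry and uniformly finite homology\<close>

definition bounded_geometry :: "'a set \<Rightarrow> ('a \<Rightarrow> 'a \<Rightarrow> real) \<Rightarrow> bool" where
  "bounded_geometry X d \<longleftrightarrow>
    (\<forall>r>0. \<exists>N. \<forall>x\<in>X. finite (Metric_space.mball X d x r) \<and> card (Metric_space.mball X d x r) \<le> N)"

definition tuples :: "'a set \<Rightarrow> nat \<Rightarrow> (nat \<Rightarrow> 'a) set" where
  "tuples X n = (\<Pi>\<^sub>E i\<in>{..n}. X)"

text \<open>Functions on \<open>tuples X n\<close> are represented by their extension by zero.\<close>

definition uf_chains ::
    "'a set \<Rightarrow> ('a \<Rightarrow> 'a \<Rightarrow> real) \<Rightarrow> nat \<Rightarrow> ((nat \<Rightarrow> 'a) \<Rightarrow> int) set" where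
  "uf_chains X d n =
    {c. (\<forall>x. x \<notin> tuples X n \<longrightarrow> c x = 0)
      \<and> (\<exists>B. \<forall>x. \<bar>c x\<bar> \<le> B)
      \<and> (\<exists>r>0. \<forall>x. c x \<noteq> 0 \<longrightarrow> (\<forall>i\<le>n. \<forall>j\<le>n. d (x i) (x j) \<le> r))}"

definition omit :: "nat \<Rightarrow> nat \<Rightarrow> (nat \<Rightarrow> 'a) \<Rightarrow> nat \<Rightarrow> 'a" where
  "omit n i x = (\<lambda>j\<in>{..<n}. x (if j < i then j else Suc j))"

definition uf_complex ::
    "'a set \<Rightarrow> ('a \<Rightarrow> 'a \<Rightarrow> real) \<Rightarrow> nat \<Rightarrow> ((nat \<Rightarrow> 'a) \<Rightarrow> int) monoid" where
  "uf_complex X d n = int_fun_group (uf_chains X d n)"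

definition uf_boundary ::
    "'a set \<Rightarrow> nat \<Rightarrow> ((nat \<Rightarrow> 'a) \<Rightarrow> int) \<Rightarrow> (nat \<Rightarrow> 'a) \<Rightarrow> int" where
  "uf_boundary X n = alternating_pushforward n (tuples X n) (omit n)"

definition uf_homology ::
    "'a set \<Rightarrow> ('a \<Rightarrow> 'a \<Rightarrow> real) \<Rightarrow> nat \<Rightarrow> ((nat \<Rightarrow> 'a) \<Rightarrow> int) set monoid" where
  "uf_homology X d = homology (uf_complex X d) (uf_boundary X)"


section \<open>Groupoid homology\<close>

text \<open>
  The product of \<open>g\<close> and \<open>h\<close> is meaningful when \<open>g_source g = g_range h\<close>.
\<close>

record ('g, 'o) top_groupoid =
  g_arrows :: "'g topology"
  g_base :: "'o topology"
  g_range :: "'g \<Rightarrow> 'o"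
  g_source :: "'g \<Rightarrow> 'o"
  g_mult :: "'g \<Rightarrow> 'g \<Rightarrow> 'g"
  g_unit :: "'o \<Rightarrow> 'g"
  g_inverse :: "'g \<Rightarrow> 'g"

text \<open>Integer valued continuous functions with compact support, extended by zero.\<close>

definition Cc_int :: "'y topology \<Rightarrow> ('y \<Rightarrow> int) set" where
  "Cc_int Y =
    {a. (\<forall>y. y \<notin> topspace Y \<longrightarrow> a y = 0)
      \<and> continuous_map Y (discrete_topology UNIV) a
      \<and> compactin Y (Y closure_of {y \<in> topspace Y. a y \<noteq> 0})}"

text \<open>
  The spaces of composable strings. To have one type for all degrees, objects (degree \<open>0\<close>) are
  tagged with \<open>Inl\<close>, and strings \<open>(g\<^sub>1, \<dots>, g\<^sub>n)\<close> with \<open>n \<ge> 1\<close> are functions on \<open>{1..n}\<close> tagged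
  with \<open>Inr\<close>; the topologies are transported along the tags.
\<close>

definition nerve :: "('g, 'o) top_groupoid \<Rightarrow> nat \<Rightarrow> ('o + (nat \<Rightarrow> 'g)) topology" where
  "nerve G n =
    (if n = 0 then pullback_topology (range Inl) projl (g_base G)
     else pullback_topology (range Inr) projr
       (subtopology (product_topology (\<lambda>_. g_arrows G) {1..n})
          {g. \<forall>i. 1 \<le> i \<and> i < n \<longrightarrow> g_source G (g i) = g_range G (g (Suc i))}))"

definition nerve_face ::
    "('g, 'o) top_groupoid \<Rightarrow> nat \<Rightarrow> nat \<Rightarrow> 'o + (nat \<Rightarrow> 'g) \<Rightarrow> 'o + (nat \<Rightarrow> 'g)" where
  "nerve_face G n i t =
    (let g = projr t in
     if n = 1 then Inl (if i = 0 then g_source G (g 1) else g_range G (g 1))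
     else if i = 0 then Inr (\<lambda>j\<in>{1..n - 1}. g (Suc j))
     else if i = n then Inr (\<lambda>j\<in>{1..n - 1}. g j)
     else Inr (\<lambda>j\<in>{1..n - 1}.
       if j < i then g j else if j = i then g_mult G (g i) (g (Suc i)) else g (Suc j)))"

definition groupoid_complex ::
    "('g, 'o) top_groupoid \<Rightarrow> nat \<Rightarrow> ('o + (nat \<Rightarrow> 'g) \<Rightarrow> int) monoid" where
  "groupoid_complex G n = int_fun_group (Cc_int (nerve G n))"

definition groupoid_boundary ::
    "('g, 'o) top_groupoid \<Rightarrow> nat \<Rightarrow> ('o + (nat \<Rightarrow> 'g) \<Rightarrow> int) \<Rightarrow> 'o + (nat \<Rightarrow> 'g) \<Rightarrow> int" where
  "groupoid_boundary G n = alternating_pushforward n (topspace (nerve G n)) (nerve_face G n)"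

definition groupoid_homology ::
    "('g, 'o) top_groupoid \<Rightarrow> nat \<Rightarrow> ('o + (nat \<Rightarrow> 'g) \<Rightarrow> int) set monoid" where
  "groupoid_homology G = homology (groupoid_complex G) (groupoid_boundary G)"


section \<open>The coarse groupoid\<close>

text \<open>
  The Stone-Cech compactification of the discrete space \<open>X\<close> is the space of ultrafilters on
  \<open>X\<close>, with basic open sets \<open>{F. A \<in> F}\<close> for \<open>A \<subseteq> X\<close>; a point \<open>x\<close> of \<open>X\<close> is identified
  with the principal ultrafilter at \<open>x\<close>.
\<close>

definition ultrafilters :: "'a set \<Rightarrow> 'a filter set" where
  "ultrafilters X =
    {F. F \<noteq> bot \<and> F \<le> principal X \<and> (\<forall>P. eventually P F \<or> eventually (\<lambda>x. \<not> P x) F)}"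

definition stone_cech :: "'a set \<Rightarrow> 'a filter topology" where
  "stone_cech X =
    topology_generated_by ((\<lambda>A. {F \<in> ultrafilters X. eventually (\<lambda>x. x \<in> A) F}) ` Pow X)"

definition sc_point :: "'a \<Rightarrow> 'a filter" where
  "sc_point x = principal {x}"

lemma topspace_stone_cech: "topspace (stone_cech X) = ultrafilters X"
proof -
  have "eventually (\<lambda>x. x \<in> X) F" if "F \<in> ultrafilters X" for F
    using that by (auto simp: ultrafilters_def le_principal)
  then have "ultrafilters X \<subseteq> {F \<in> ultrafilters X. eventually (\<lambda>x. x \<in> X) F}"
    by blast
  then show ?thesis
    unfolding stone_cech_def topology_generated_by_topspace by blast
qed

lemma sc_point_in_stone_cech: "x \<in> X \<Longrightarrow> sc_point x \<in> topspace (stone_cech X)"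
  by (auto simp: topspace_stone_cech ultrafilters_def sc_point_def eventually_principal
      principal_eq_bot_iff)

definition coarse_entourage ::
    "'a set \<Rightarrow> ('a \<Rightarrow> 'a \<Rightarrow> real) \<Rightarrow> real \<Rightarrow> ('a filter \<times> 'a filter) set" where
  "coarse_entourage X d r =
    prod_topology (stone_cech X) (stone_cech X) closure_of
      {(sc_point x, sc_point y) | x y. x \<in> X \<and> y \<in> X \<and> d x y \<le> r}"

definition coarse_arrows ::
    "'a set \<Rightarrow> ('a \<Rightarrow> 'a \<Rightarrow> real) \<Rightarrow> ('a filter \<times> 'a filter) topology" where
  "coarse_arrows X d =
    topology (\<lambda>U. U \<subseteq> (\<Union>r\<in>{0<..}. coarse_entourage X d r) \<and>
      (\<forall>r>0. openin
        (subtopology (prod_topology (stone_cech X) (stone_cech X)) (coarse_entourage X d r))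
        (U \<inter> coarse_entourage X d r)))"

lemma openin_coarse_arrows:
  "openin (coarse_arrows X d) U \<longleftrightarrow>
    U \<subseteq> (\<Union>r\<in>{0<..}. coarse_entourage X d r) \<and>
      (\<forall>r>0. openin
        (subtopology (prod_topology (stone_cech X) (stone_cech X)) (coarse_entourage X d r))
        (U \<inter> coarse_entourage X d r))"
proof -
  let ?E = "coarse_entourage X d"
  let ?T = "\<lambda>r. subtopology (prod_topology (stone_cech X) (stone_cech X)) (?E r)"
  have "istopology (\<lambda>U. U \<subseteq> (\<Union>r\<in>{0<..}. ?E r) \<and> (\<forall>r>0. openin (?T r) (U \<inter> ?E r)))"
    unfolding istopology_def
  proof (intro conjI allI impI)
    fix S T :: "('a filter \<times> 'a filter) set" and r :: real
    assume S: "S \<subseteq> (\<Union>r\<in>{0<..}. ?E r) \<and> (\<forall>r>0. openin (?T r) (S \<inter> ?E r))"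
      and T: "T \<subseteq> (\<Union>r\<in>{0<..}. ?E r) \<and> (\<forall>r>0. openin (?T r) (T \<inter> ?E r))"
    show "S \<inter> T \<subseteq> (\<Union>r\<in>{0<..}. ?E r)"
      using S by blast
    assume "0 < r"
    then have "openin (?T r) (S \<inter> ?E r)" and "openin (?T r) (T \<inter> ?E r)"
      using S T by blast+
    then have "openin (?T r) ((S \<inter> ?E r) \<inter> (T \<inter> ?E r))"
      by (rule openin_Int)
    moreover have "(S \<inter> ?E r) \<inter> (T \<inter> ?E r) = S \<inter> T \<inter> ?E r"
      by blast
    ultimately show "openin (?T r) (S \<inter> T \<inter> ?E r)"
      by (simp only:)
  next
    fix K :: "('a filter \<times> 'a filter) set set" and r :: real
    assume K: "\<forall>U\<in>K. U \<subseteq> (\<Union>r\<in>{0<..}. ?E r) \<and> (\<forall>r>0. openin (?T r) (U \<inter> ?E r))"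
    show "\<Union> K \<subseteq> (\<Union>r\<in>{0<..}. ?E r)"
      using K by blast
    assume "0 < r"
    then have "openin (?T r) (\<Union>U\<in>K. U \<inter> ?E r)"
      using K by (intro openin_Union ballI) blast
    then show "openin (?T r) (\<Union> K \<inter> ?E r)"
      by (simp only: Int_Union2)
  qed
  then show ?thesis
    unfolding coarse_arrows_def by (simp only: topology_inverse')
qed

lemma topspace_coarse_arrows:
  "topspace (coarse_arrows X d) = (\<Union>r\<in>{0<..}. coarse_entourage X d r)"
proof (rule subset_antisym)
  let ?E = "coarse_entourage X d" and ?P = "prod_topology (stone_cech X) (stone_cech X)"
  show "topspace (coarse_arrows X d) \<subseteq> (\<Union>r\<in>{0<..}. ?E r)"
    using openin_coarse_arrows openin_topspace by meson
  have "openin (subtopology ?P (?E s)) ((\<Union>r\<in>{0<..}. ?E r) \<inter> ?E s)" if "s > 0" for s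
  proof -
    have "?E s \<subseteq> topspace ?P"
      unfolding coarse_entourage_def by (rule closure_of_subset_topspace)
    moreover have "(\<Union>r\<in>{0<..}. ?E r) \<inter> ?E s = ?E s"
      using that by blast
    ultimately show ?thesis
      by (metis openin_topspace topspace_subtopology_subset)
  qed
  then have "openin (coarse_arrows X d) (\<Union>r\<in>{0<..}. ?E r)"
    unfolding openin_coarse_arrows by blast
  then show "(\<Union>r\<in>{0<..}. ?E r) \<subseteq> topspace (coarse_arrows X d)"
    by (rule openin_subset)
qed

definition coarse_groupoid ::
    "'a set \<Rightarrow> ('a \<Rightarrow> 'a \<Rightarrow> real) \<Rightarrow> ('a filter \<times> 'a filter, 'a filter) top_groupoid" where
  "coarse_groupoid X d =
    \<lparr>g_arrows = coarse_arrows X d,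
     g_base = stone_cech X,
     g_range = fst,
     g_source = snd,
     g_mult = (\<lambda>g h. (fst g, snd h)),
     g_unit = (\<lambda>u. (u, u)),
     g_inverse = (\<lambda>g. (snd g, fst g))\<rparr>"


section \<open>The canonical comparison map\<close>

text \<open>
  The canonical map is restriction of chains along the inclusion of \<open>X\<^sup>n\<^sup>+\<^sup>1\<close> into composable
  strings, \<open>(x\<^sub>0, \<dots>, x\<^sub>n) \<mapsto> ((x\<^sub>0, x\<^sub>1), \<dots>, (x\<^sub>n\<^sub>-\<^sub>1, x\<^sub>n))\<close>, and \<open>x\<^sub>0 \<mapsto> x\<^sub>0\<close> in degree \<open>0\<close>.
  A string whose consecutive pairs lie in \<open>X \<times> X\<close> automatically lies in the nerve, because any
  pair of points of \<open>X\<close> is at finite distance.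
\<close>

definition tuple_string :: "nat \<Rightarrow> (nat \<Rightarrow> 'a) \<Rightarrow> 'a filter + (nat \<Rightarrow> 'a filter \<times> 'a filter)" where
  "tuple_string n x =
    (if n = 0 then Inl (sc_point (x 0))
     else Inr (\<lambda>k\<in>{1..n}. (sc_point (x (k - 1)), sc_point (x k))))"

definition restrict_chain ::
    "'a set \<Rightarrow> nat \<Rightarrow> ('a filter + (nat \<Rightarrow> 'a filter \<times> 'a filter) \<Rightarrow> int) \<Rightarrow> (nat \<Rightarrow> 'a) \<Rightarrow> int" where
  "restrict_chain X n a = (\<lambda>x. if x \<in> tuples X n then a (tuple_string n x) else 0)"

end

theory Submission
  imports Defs
begin

text \<open>
  Restriction to tuples of points is already an isomorphism of chain complexes. Say that an
  ultrafilter \<open>W\<close> on \<open>X\<^sup>n\<^sup>+\<^sup>1\<close> is controlled if it contains the set \<open>\<Delta>\<^sub>r\<close> of all tuples of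
  diameter at most \<open>r\<close>, for some \<open>r\<close>. By bounded geometry \<open>X\<close> has a finite colouring that
  separates points at distance at most \<open>2r\<close>, so \<open>\<Delta>\<^sub>r\<close> is a finite union of sets on which every
  coordinate, and every face map, is injective. Hence a controlled ultrafilter is determined by its
  marginals \<open>u\<^sub>0, \<dots>, u\<^sub>n\<close>, and \<open>W \<mapsto> ((u\<^sub>0, u\<^sub>1), \<dots>, (u\<^sub>n\<^sub>-\<^sub>1, u\<^sub>n))\<close> is a homeomorphism from the
  space of controlled ultrafilters onto the nerve. A compact set lies in the image of a single
  \<open>\<Delta>\<^sub>r\<close>, so the compactly supported continuous functions on the nerve are exactly the functions
  \<open>W \<mapsto> lim\<^sub>W c\<close> for uniformly finite chains \<open>c\<close>. On each piece on which a face map is injective, an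
  ultrafilter below lifts uniquely, so the limit commutes with pushing forward along the face.
\<close>

section \<open>Ultrafilters\<close>

text \<open>The obstacle is that an ultrafilter on a product is in general not determined by its
  marginals: for a free ultrafilter u on X, the image of u on the diagonal and the tensor square of
  u are different, yet both have marginals u and u. Points of the nerve only record marginals, so
  control has to remove this ambiguity. It does so because two tuples of diameter at most r that
  share one coordinate differ by at most 2r in every other one, whence the constant in the
  colouring. Two features of the nerve need separate work. It constrains consecutive pairs only, so
  the triangle inequality must turn bounds on arrows into bounds on whole tuples. And the arrows
  carry a direct limit topology; that every E_r is open in it is what makes the images of the sets
  \<Delta>_r an open exhaustion of the nerve, to which compactness can be applied.\<close>

definition ultra :: "'a filter \<Rightarrow> bool" where
  "ultra F \<longleftrightarrow> F \<noteq> bot \<and> (\<forall>P. eventually P F \<or> eventually (\<lambda>x. \<not> P x) F)"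

lemma ultrafilters_iff: "F \<in> ultrafilters X \<longleftrightarrow> ultra F \<and> eventually (\<lambda>x. x \<in> X) F"
  by (auto simp: ultrafilters_def ultra_def le_principal)

lemma ultra_not_bot: "ultra F \<Longrightarrow> F \<noteq> bot"
  by (simp add: ultra_def)

lemma ultra_exD: "ultra F \<Longrightarrow> eventually P F \<Longrightarrow> \<exists>x. P x"
  using eventually_happens ultra_not_bot by metis

lemma ultra_Not: "ultra F \<Longrightarrow> eventually (\<lambda>x. \<not> P x) F \<longleftrightarrow> \<not> eventually P F"
  unfolding ultra_def using eventually_conj[of P F "\<lambda>x. \<not> P x"] by (auto simp: trivial_limit_def)

text \<open>If every \<open>P j\<close> failed to be eventual, finitely many negations would hold
  jointly. This lets an ultrafilter choose one piece of a finite colouring.\<close>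

lemma ultra_ex_finite:
  assumes "ultra F" "finite J" "eventually (\<lambda>x. \<exists>j\<in>J. P j x) F"
  shows "\<exists>j\<in>J. eventually (P j) F"
proof (rule ccontr)
  assume "\<not> ?thesis"
  then have "eventually (\<lambda>x. \<forall>j\<in>J. \<not> P j x) F"
    using assms by (intro eventually_ball_finite) (auto simp: ultra_Not)
  with assms(3) have "eventually (\<lambda>x. False) F"
    by eventually_elim blast
  with assms(1) show False
    by (simp add: ultra_def trivial_limit_def)
qed

lemma ultra_filtermap: "ultra F \<Longrightarrow> ultra (filtermap f F)"
  by (auto simp: ultra_def eventually_filtermap filtermap_bot_iff)

lemma ultra_principal: "ultra (principal {x})"
  by (auto simp: ultra_def eventually_principal principal_eq_bot_iff)

text \<open>A smaller filter has more eventual properties, so ultrafilters are the minimal proper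
  filters.\<close>

lemma ultra_le_eq:
  assumes "ultra F" "G \<noteq> bot" "G \<le> F"
  shows "G = F"
proof (rule antisym[OF assms(3)], rule filter_leI)
  fix P assume P: "eventually P G"
  show "eventually P F"
  proof (rule ccontr)
    assume "\<not> eventually P F"
    then have "eventually (\<lambda>x. \<not> P x) G"
      using assms(1,3) by (auto simp: ultra_Not[symmetric] intro: filter_leD)
    with P have "eventually (\<lambda>x. False) G"
      by eventually_elim blast
    with assms(2) show False
      by (simp add: trivial_limit_def)
  qed
qed

lemma ultra_exists:
  assumes "F \<noteq> bot"
  shows "\<exists>W. ultra W \<and> W \<le> F"
proof -
  let ?A = "{G. G \<noteq> bot \<and> G \<le> F}"
  \<comment> \<open>The order is reversed, so that the maximal element from Zorn's lemma is a
    minimal proper filter.\<close>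
  let ?P = "\<lambda>G H :: 'a filter. H \<le> G"
  have "\<exists>M\<in>?A. \<forall>G\<in>?A. ?P M G \<longrightarrow> G = M"
  proof (rule predicate_Zorn)
    show "partial_order_on ?A (relation_of ?P ?A)"
      by (rule partial_order_on_relation_ofI) auto
  next
    fix C assume C: "C \<in> Chains (relation_of ?P ?A)"
    then have CA: "C \<subseteq> ?A"
      by (auto simp: Chains_def relation_of_def)
    have ch: "G \<le> H \<or> H \<le> G" if "G \<in> C" "H \<in> C" for G H
      using C that by (auto simp: Chains_def relation_of_def)
    show "\<exists>u\<in>?A. \<forall>a\<in>C. ?P a u"
    proof (cases "C = {}")
      case True
      with assms show ?thesis by auto
    next
      case False
      \<comment> \<open>A chain is directed downwards, so a property eventual for
        \<open>Inf C\<close> is already eventual for a member, and \<open>False\<close> is eventual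
        for none.\<close>
      have "Inf C \<noteq> bot"
      proof
        assume "Inf C = bot"
        then have "eventually (\<lambda>x. False) (Inf C)"
          by simp
        moreover have "\<exists>x\<in>C. x \<le> inf G H" if "G \<in> C" "H \<in> C" for G H
          using ch[OF that] that by (metis inf.orderE inf_commute order_refl)
        ultimately obtain b where "b \<in> C" "eventually (\<lambda>x. False) b"
          using eventually_Inf_base[OF False] by blast
        with CA show False
          by (auto simp: trivial_limit_def)
      qed
      moreover have "Inf C \<le> F"
        using False CA by (metis (mono_tags, lifting) Inf_lower2 ex_in_conv mem_Collect_eq subsetD)
      ultimately show ?thesis
        by (auto intro: Inf_lower)
    qed
  qed
  then obtain M where M: "M \<noteq> bot" "M \<le> F" and max: "\<forall>G\<in>?A. G \<le> M \<longrightarrow> G = M"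
    by blast
  have min: "G = M" if "G \<noteq> bot" "G \<le> M" for G
    using max that order_trans[OF that(2) M(2)] by simp
  have "ultra M"
    unfolding ultra_def
  proof (intro conjI allI M(1))
    fix P
    show "eventually P M \<or> eventually (\<lambda>x. \<not> P x) M"
    \<comment> \<open>By minimality, adding the event \<open>P\<close> to \<open>M\<close> either
      yields the improper filter or changes nothing.\<close>
    proof (cases "inf M (principal {x. P x}) = bot")
      case True
      then have "eventually (\<lambda>x. False) (inf M (principal {x. P x}))"
        by simp
      then show ?thesis
        by (simp add: eventually_inf_principal)
    next
      case False
      then have "inf M (principal {x. P x}) = M"
        by (intro min) auto
      moreover have "eventually P (inf M (principal {x. P x}))"
        by (simp add: eventually_inf_principal)
      ultimately show ?thesis
        by simp
    qed
  qed
  with M show ?thesis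
    by blast
qed

lemma filtermap_eq_self:
  assumes "eventually (\<lambda>x. f x = x) F"
  shows "filtermap f F = F"
  using assms unfolding filter_eq_iff eventually_filtermap
  by (auto elim: eventually_elim2)

text \<open>The map \<open>inv_into T p\<close> undoes \<open>p\<close> on \<open>T\<close>, so a
  filter charging \<open>T\<close> is recovered from its image under \<open>p\<close>.\<close>

lemma filter_eq_if_inj_on:
  assumes "inj_on p T" "eventually (\<lambda>x. x \<in> T) F" "eventually (\<lambda>x. x \<in> T) G"
    and "filtermap p F = filtermap p G"
  shows "F = G"
proof -
  have "filtermap (inv_into T p) (filtermap p H) = H" if "eventually (\<lambda>x. x \<in> T) H" for H
    unfolding filtermap_filtermap
    using that by (intro filtermap_eq_self) (auto elim!: eventually_mono simp: assms(1))
  then show ?thesis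
    using assms by metis
qed

subsection \<open>Limits of finitely valued functions along ultrafilters\<close>

text \<open>For finitely valued \<open>c\<close> this is the value at \<open>W\<close> of the
  continuous extension of \<open>c\<close> to ultrafilters. The target type is left open because
  colourings, too, are evaluated in this way.\<close>

definition ulim :: "('a \<Rightarrow> 'b) \<Rightarrow> 'a filter \<Rightarrow> 'b" where
  "ulim c W = (THE v. eventually (\<lambda>x. c x = v) W)"

lemma ulim_eqI:
  assumes "ultra W" "eventually (\<lambda>x. c x = v) W"
  shows "ulim c W = v"
  unfolding ulim_def
proof (rule the_equality, rule assms(2))
  fix u assume "eventually (\<lambda>x. c x = u) W"
  with assms(2) have "eventually (\<lambda>x. u = v) W"
    by eventually_elim simp
  with ultra_exD[OF assms(1)] show "u = v"
    by blast
qed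

text \<open>Finiteness is asked only along \<open>W\<close>: a colouring may be known to take
  finitely many values only on the support of a chain.\<close>

lemma eventually_ulim_mem:
  assumes "ultra W" "finite J" "eventually (\<lambda>x. c x \<in> J) W"
  shows "ulim c W \<in> J" "eventually (\<lambda>x. c x = ulim c W) W"
proof -
  have "eventually (\<lambda>x. \<exists>v\<in>J. c x = v) W"
    using assms(3) by eventually_elim blast
  then obtain v where v: "v \<in> J" "eventually (\<lambda>x. c x = v) W"
    using ultra_ex_finite[OF assms(1,2), of "\<lambda>v x. c x = v"] by blast
  with ulim_eqI[OF assms(1) v(2)] show "ulim c W \<in> J" "eventually (\<lambda>x. c x = ulim c W) W"
    by auto
qed

lemma eventually_ulim:
  assumes "ultra W" "finite (range c)"
  shows "eventually (\<lambda>x. c x = ulim c W) W"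
  using eventually_ulim_mem(2)[OF assms] by simp

lemma ulim_principal [simp]: "ulim c (principal {x}) = c x"
  by (rule ulim_eqI) (auto simp: ultra_principal eventually_principal)

lemma ulim_nonzero:
  assumes "ultra W" "finite (range c)"
  shows "ulim c W \<noteq> 0 \<longleftrightarrow> eventually (\<lambda>x. c x \<noteq> (0::int)) W"
proof
  assume "ulim c W \<noteq> 0"
  with eventually_ulim[OF assms] show "eventually (\<lambda>x. c x \<noteq> 0) W"
    by (auto elim: eventually_mono)
next
  assume "eventually (\<lambda>x. c x \<noteq> 0) W"
  with eventually_ulim[OF assms] have "eventually (\<lambda>x. ulim c W \<noteq> 0) W"
    by eventually_elim simp
  then show "ulim c W \<noteq> 0"
    using ultra_exD[OF assms(1)] by blast
qed

text \<open>
  The colouring \<open>\<kappa>\<close> cuts the support of \<open>c\<close> into finitely many pieces on which \<open>p\<close> is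
  injective. An ultrafilter over \<open>W'\<close> that charges the support concentrates on one piece and is
  the image of \<open>W'\<close> under the inverse of \<open>p\<close> on that piece.
\<close>

lemma
  fixes c :: "'y \<Rightarrow> int" and p :: "'y \<Rightarrow> 'z" and \<kappa> :: "'y \<Rightarrow> 'k"
  assumes J: "finite J" "\<And>y. c y \<noteq> 0 \<Longrightarrow> \<kappa> y \<in> J"
    and inj: "\<And>y y'. c y \<noteq> 0 \<Longrightarrow> c y' \<noteq> 0 \<Longrightarrow> \<kappa> y = \<kappa> y' \<Longrightarrow> p y = p y' \<Longrightarrow> y = y'"
    and Y: "\<And>y. c y \<noteq> 0 \<Longrightarrow> y \<in> Y"
  shows ulim_pushforward: "\<And>W'. finite (range c) \<Longrightarrow> ultra W' \<Longrightarrow>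
      (\<Sum>W | ultra W \<and> filtermap p W = W' \<and> ulim c W \<noteq> 0. ulim c W) = ulim (pushforward Y p c) W'"
    and abs_pushforward_le: "\<And>z B. (\<And>y. \<bar>c y\<bar> \<le> B) \<Longrightarrow> \<bar>pushforward Y p c z\<bar> \<le> int (card J) * B"
proof -
  define S where "S j = {y. c y \<noteq> 0 \<and> \<kappa> y = j}" for j
  define s where "s j = inv_into (S j) p" for j
  have injS: "inj_on p (S j)" for j
    using inj by (auto simp: inj_on_def S_def)
  have s1: "s j z \<in> S j \<and> p (s j z) = z" if "z \<in> p ` S j" for j z
    using that by (auto simp: s_def inv_into_into f_inv_into_f)
  have s2: "s j (p y) = y" if "y \<in> S j" for j y
    using that injS by (simp add: s_def)
  \<comment> \<open>A fibre meets each piece at most once, so its nonzero terms can be indexed by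
    colours, with section \<open>s j\<close> picking the term of colour \<open>j\<close>.\<close>
  have pf: "pushforward Y p c z = (\<Sum>j | j \<in> J \<and> z \<in> p ` S j. c (s j z))" for z
    unfolding pushforward_def
  proof (rule sum.reindex_bij_witness[where i = "\<lambda>j. s j z" and j = \<kappa>], goal_cases)
    case (1 y)
    then show ?case using s2[of y "\<kappa> y"] by (auto simp: S_def)
  next
    case (2 y)
    then show ?case using J by (auto simp: S_def)
  next
    case (3 j)
    then show ?case using s1[of z j] by (auto simp: S_def)
  next
    case (4 j)
    then show ?case using s1[of z j] Y by (auto simp: S_def)
  next
    case (5 y)
    then show ?case using s2[of y "\<kappa> y"] by (auto simp: S_def)
  qed
  show "\<bar>pushforward Y p c z\<bar> \<le> int (card J) * B" if B: "\<And>y. \<bar>c y\<bar> \<le> B" for z B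
  proof -
    have "\<bar>pushforward Y p c z\<bar> \<le> (\<Sum>j | j \<in> J \<and> z \<in> p ` S j. B)"
      unfolding pf by (rule order_trans[OF sum_abs sum_mono]) (rule B)
    also have "\<dots> = int (card {j \<in> J. z \<in> p ` S j}) * B"
      by simp
    also have "\<dots> \<le> int (card J) * B"
      \<comment> \<open>The bound at an arbitrary point gives \<open>0 \<le> B\<close>, needed to
        enlarge the index set to \<open>J\<close>.\<close>
      using J(1) B[of undefined] by (intro mult_right_mono) (auto intro: card_mono)
    finally show ?thesis .
  qed
  fix W' :: "'z filter" assume fin: "finite (range c)" and W': "ultra W'"
  \<comment> \<open>The colours whose piece has a \<open>W'\<close>-large image. Each such piece
    carries one lift of \<open>W'\<close>, and by \<open>lift\<close> below every contributing
    \<open>W\<close> arises in this way.\<close>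
  define J' where "J' = {j \<in> J. eventually (\<lambda>z. z \<in> p ` S j) W'}"
  have over: "filtermap p (filtermap (s j) W') = W'" if "j \<in> J'" for j
    unfolding filtermap_filtermap using that s1
    by (intro filtermap_eq_self) (auto simp: J'_def elim!: eventually_mono)
  have inS: "eventually (\<lambda>y. y \<in> S j) (filtermap (s j) W')" if "j \<in> J'" for j
    using that s1 by (auto simp: J'_def eventually_filtermap elim!: eventually_mono)
  have lift: "\<exists>j. j = ulim \<kappa> W \<and> j \<in> J' \<and> filtermap (s j) W' = W"
    if W: "ultra W" "filtermap p W = W'" "ulim c W \<noteq> 0" for W
  proof -
    have nz: "eventually (\<lambda>y. c y \<noteq> 0) W"
      using ulim_nonzero[OF W(1) fin] W(3) by blast
    then have "eventually (\<lambda>y. \<kappa> y \<in> J) W"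
      by eventually_elim (rule J)
    note k = eventually_ulim_mem[OF W(1) J(1) this]
    have evS: "eventually (\<lambda>y. y \<in> S (ulim \<kappa> W)) W"
      using nz k(2) by eventually_elim (simp add: S_def)
    have "eventually (\<lambda>z. z \<in> p ` S (ulim \<kappa> W)) W'"
      unfolding W(2)[symmetric] eventually_filtermap using evS by eventually_elim blast
    moreover have "filtermap (s (ulim \<kappa> W)) W' = W"
      unfolding W(2)[symmetric] filtermap_filtermap
      using evS s2 by (intro filtermap_eq_self) (auto elim!: eventually_mono)
    ultimately show ?thesis
      using k(1) by (simp add: J'_def)
  qed
  have "(\<Sum>W | ultra W \<and> filtermap p W = W' \<and> ulim c W \<noteq> 0. ulim c W)
      = (\<Sum>j\<in>J'. ulim c (filtermap (s j) W'))"
  proof (rule sum.reindex_bij_witness[where i = "\<lambda>j. filtermap (s j) W'" and j = "ulim \<kappa>"],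
      goal_cases)
    case (1 W)
    then show ?case using lift[of W] by auto
  next
    case (2 W)
    then show ?case using lift[of W] by auto
  next
    case (3 j)
    show ?case
      using inS[OF 3] by (intro ulim_eqI ultra_filtermap W') (auto simp: S_def elim: eventually_mono)
  next
    case (4 j)
    have "ulim c (filtermap (s j) W') \<noteq> 0"
      unfolding ulim_nonzero[OF ultra_filtermap[OF W'] fin]
      using inS[OF 4] by (auto simp: S_def elim: eventually_mono)
    with over[OF 4] ultra_filtermap[OF W'] show ?case by blast
  next
    case (5 W)
    then show ?case using lift[of W] by auto
  qed
  also have "\<dots> = ulim (pushforward Y p c) W'"
  proof (rule ulim_eqI[OF W', symmetric])
    \<comment> \<open>For \<open>W'\<close>-almost every point the colours occurring in its fibre
      are exactly those in \<open>J'\<close>, so pointwise sum and sum of limits share one finite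
      index set.\<close>
    have "eventually (\<lambda>z. (z \<in> p ` S j \<longleftrightarrow> j \<in> J') \<and> c (s j z) = ulim c (filtermap (s j) W')) W'"
      if "j \<in> J" for j
    proof -
      have "eventually (\<lambda>z. z \<in> p ` S j \<longleftrightarrow> j \<in> J') W'"
      proof (cases "j \<in> J'")
        case True
        then show ?thesis by (auto simp: J'_def)
      next
        case False
        then show ?thesis using that W' by (simp add: J'_def ultra_Not)
      qed
      moreover have "eventually (\<lambda>z. c (s j z) = ulim c (filtermap (s j) W')) W'"
        using eventually_ulim[OF ultra_filtermap[OF W'] fin, of "s j"]
        by (simp add: eventually_filtermap)
      ultimately show ?thesis
        by (rule eventually_conj)
    qed
    then have "eventually (\<lambda>z. \<forall>j\<in>J. (z \<in> p ` S j \<longleftrightarrow> j \<in> J')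
        \<and> c (s j z) = ulim c (filtermap (s j) W')) W'"
      by (intro eventually_ball_finite J ballI)
    then show "eventually (\<lambda>z. pushforward Y p c z = (\<Sum>j\<in>J'. ulim c (filtermap (s j) W'))) W'"
    proof eventually_elim
      case (elim z)
      then have "{j. j \<in> J \<and> z \<in> p ` S j} = J'"
        by (auto simp: J'_def)
      moreover have "(\<Sum>j\<in>J'. c (s j z)) = (\<Sum>j\<in>J'. ulim c (filtermap (s j) W'))"
        using elim by (intro sum.cong) (auto simp: J'_def)
      ultimately show ?case
        by (simp add: pf)
    qed
  qed
  finally show "(\<Sum>W | ultra W \<and> filtermap p W = W' \<and> ulim c W \<noteq> 0. ulim c W)
      = ulim (pushforward Y p c) W'" .
qed

section \<open>Colourings of graphs of bounded degree\<close>

lemma bounded_degree_colouring: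
  fixes E :: "'a \<Rightarrow> 'a \<Rightarrow> bool"
  assumes sym: "\<And>x y. E x y \<Longrightarrow> E y x"
    and deg: "\<And>x. finite {y. E x y}" "\<And>x. card {y. E x y} \<le> N"
  shows "\<exists>\<kappa> :: 'a \<Rightarrow> nat. (\<forall>x. \<kappa> x \<le> N) \<and> (\<forall>x y. E x y \<longrightarrow> \<kappa> x = \<kappa> y \<longrightarrow> x = y)"
proof -
  obtain r :: "'a rel" where r: "well_order_on UNIV r"
    using well_order_on by blast
  define q where "q = r - Id"
  have wf: "wf q" and tot: "(x, y) \<in> q \<or> (y, x) \<in> q \<or> x = y" for x y
    using r by (auto simp: well_order_on_def linear_order_on_def total_on_def q_def)
  define \<kappa> :: "'a \<Rightarrow> nat" where
    "\<kappa> = wfrec q (\<lambda>f x. LEAST k. k \<notin> f ` {y. E x y \<and> (y, x) \<in> q})"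
  have \<kappa>: "\<kappa> x = (LEAST k. k \<notin> \<kappa> ` {y. E x y \<and> (y, x) \<in> q})" for x
  proof -
    \<comment> \<open>Only colours of earlier vertices are read, so the cut-off of the recursion has
      no effect.\<close>
    have "cut \<kappa> q x ` {y. E x y \<and> (y, x) \<in> q} = \<kappa> ` {y. E x y \<and> (y, x) \<in> q}"
      by (intro image_cong) (auto simp: cut_def)
    then show ?thesis
      using def_wfrec[OF \<kappa>_def[THEN eq_reflection] wf, of x] by simp
  qed
  \<comment> \<open>At most \<open>N\<close> neighbours cannot occupy all \<open>N + 1\<close>
    colours.\<close>
  have ex: "\<exists>k\<le>N. k \<notin> \<kappa> ` {y. E x y \<and> (y, x) \<in> q}" for x
  proof (rule ccontr)
    assume "\<not> ?thesis"
    then have "{..N} \<subseteq> \<kappa> ` {y. E x y \<and> (y, x) \<in> q}"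
      by auto
    also have "\<dots> \<subseteq> \<kappa> ` {y. E x y}"
      by auto
    finally have "card {..N} \<le> card (\<kappa> ` {y. E x y})"
      using deg(1) by (intro card_mono) auto
    also have "\<dots> \<le> N"
      using card_image_le[OF deg(1)] deg(2) order_trans by blast
    finally show False
      by simp
  qed
  have notin: "\<kappa> x \<notin> \<kappa> ` {y. E x y \<and> (y, x) \<in> q}" and le: "\<kappa> x \<le> N" for x
  proof -
    obtain k where k: "k \<le> N" "k \<notin> \<kappa> ` {y. E x y \<and> (y, x) \<in> q}"
      using ex by blast
    show "\<kappa> x \<notin> \<kappa> ` {y. E x y \<and> (y, x) \<in> q}"
      using LeastI[of "\<lambda>k. k \<notin> \<kappa> ` {y. E x y \<and> (y, x) \<in> q}", OF k(2)]
      by (simp only: \<kappa>[symmetric] not_False_eq_True)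
    show "\<kappa> x \<le> N"
      using Least_le[of "\<lambda>k. k \<notin> \<kappa> ` {y. E x y \<and> (y, x) \<in> q}", OF k(2)] k(1)
      by (simp only: \<kappa>[symmetric])
  qed
  have "\<kappa> x \<noteq> \<kappa> y" if "E x y" "x \<noteq> y" for x y
    using tot[of x y] notin[of x] notin[of y] that sym by (metis (mono_tags, lifting) image_eqI mem_Collect_eq)
  with le show ?thesis
    by blast
qed

section \<open>Isomorphic complexes have isomorphic homology\<close>

text \<open>Injectivity together with commutation transports kernels, surjectivity one degree up
  transports boundaries, and cosets follow. The induced map is the direct image of cosets.\<close>

lemma
  fixes \<rho> :: "nat \<Rightarrow> 'c \<Rightarrow> 'd"
  assumes mon: "\<And>n. monoid (C n)" "\<And>n. monoid (C' n)"
    and iso: "\<And>n. \<rho> n \<in> iso (C n) (C' n)"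
    and D: "\<And>n. D (Suc n) \<in> carrier (C (Suc n)) \<rightarrow> carrier (C n)"
    and comm: "\<And>n a. a \<in> carrier (C (Suc n)) \<Longrightarrow> D' (Suc n) (\<rho> (Suc n) a) = \<rho> n (D (Suc n) a)"
  shows iso_cycles: "a \<in> cycles C D n \<Longrightarrow> \<rho> n a \<in> cycles C' D' n"
    and iso_homology_class:
      "a \<in> cycles C D n \<Longrightarrow> \<rho> n ` homology_class C D n a = homology_class C' D' n (\<rho> n a)"
    and iso_homology: "(`) (\<rho> n) \<in> iso (homology C D n) (homology C' D' n)"
proof -
  have bij: "bij_betw (\<rho> n) (carrier (C n)) (carrier (C' n))"
    and mult: "\<And>a b. a \<in> carrier (C n) \<Longrightarrow> b \<in> carrier (C n) \<Longrightarrow>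
        \<rho> n (a \<otimes>\<^bsub>C n\<^esub> b) = \<rho> n a \<otimes>\<^bsub>C' n\<^esub> \<rho> n b" for n
    using iso[of n] by (auto simp: iso_def hom_def)
  have inj: "inj_on (\<rho> n) (carrier (C n))" and im: "\<rho> n ` carrier (C n) = carrier (C' n)" for n
    using bij by (auto simp: bij_betw_def)
  \<comment> \<open>Membership in \<open>iso\<close> only provides compatibility with products; a
    preimage \<open>e\<close> of the neutral element supplies the rest.\<close>
  have one: "\<rho> n \<one>\<^bsub>C n\<^esub> = \<one>\<^bsub>C' n\<^esub>" for n
  proof -
    obtain e where e: "e \<in> carrier (C n)" "\<rho> n e = \<one>\<^bsub>C' n\<^esub>"
      using im[of n] monoid.one_closed[OF mon(2)] by (metis imageE)
    have "\<rho> n \<one>\<^bsub>C n\<^esub> = \<rho> n \<one>\<^bsub>C n\<^esub> \<otimes>\<^bsub>C' n\<^esub> \<one>\<^bsub>C' n\<^esub>"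
      using monoid.r_one[OF mon(2)] monoid.one_closed[OF mon(1)] im by (metis imageI)
    also have "\<dots> = \<rho> n (\<one>\<^bsub>C n\<^esub> \<otimes>\<^bsub>C n\<^esub> e)"
      using e monoid.one_closed[OF mon(1)] by (simp add: mult)
    also have "\<dots> = \<one>\<^bsub>C' n\<^esub>"
      using e monoid.l_one[OF mon(1)] by simp
    finally show ?thesis .
  qed
  have cyc_sub: "cycles C D n \<subseteq> carrier (C n)"
    by (auto simp: cycles_def kernel_def)
  have cyc_iff: "\<rho> n z \<in> cycles C' D' n \<longleftrightarrow> z \<in> cycles C D n" if z: "z \<in> carrier (C n)" for z
  proof (cases n)
    case 0
    then show ?thesis
      using z im[of 0] by (auto simp: cycles_def)
  next
    case (Suc m)
    have "D' n (\<rho> n z) = \<one>\<^bsub>C' m\<^esub> \<longleftrightarrow> \<rho> m (D n z) = \<rho> m \<one>\<^bsub>C m\<^esub>"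
      using comm[of z m] z by (simp add: Suc one)
    also have "\<dots> \<longleftrightarrow> D n z = \<one>\<^bsub>C m\<^esub>"
      using inj_on_eq_iff[OF inj[of m]] D[of m] z monoid.one_closed[OF mon(1)] Suc by blast
    finally show ?thesis
      using z im[of n] by (auto simp: cycles_def kernel_def Suc)
  qed
  then show "a \<in> cycles C D n \<Longrightarrow> \<rho> n a \<in> cycles C' D' n"
    using cyc_sub by blast
  have cyc_im: "cycles C' D' n = \<rho> n ` cycles C D n"
  proof (intro equalityI subsetI)
    fix y assume y: "y \<in> cycles C' D' n"
    then have "y \<in> \<rho> n ` carrier (C n)"
      unfolding im by (auto simp: cycles_def kernel_def split: if_splits)
    then obtain z where "z \<in> carrier (C n)" "y = \<rho> n z"
      by blast
    with y cyc_iff show "y \<in> \<rho> n ` cycles C D n"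
      by simp
  next
    fix y assume "y \<in> \<rho> n ` cycles C D n"
    then show "y \<in> cycles C' D' n"
      using cyc_iff cyc_sub by auto
  qed
  have bd_sub: "boundaries C D n \<subseteq> carrier (C n)"
    using D[of n] by (auto simp: boundaries_def)
  have bd_im: "boundaries C' D' n = \<rho> n ` boundaries C D n"
    unfolding boundaries_def im[of "Suc n", symmetric] image_image
    by (rule image_cong) (auto simp: comm)
  have class_sub: "homology_class C D n z \<subseteq> carrier (C n)" if "z \<in> cycles C D n" for z
    using that cyc_sub bd_sub
    by (auto simp: homology_class_def r_coset_def intro!: monoid.m_closed[OF mon(1)])
  have class_im: "\<rho> n ` homology_class C D n z = homology_class C' D' n (\<rho> n z)"
    if "z \<in> cycles C D n" for z
  proof -
    have "\<rho> n ` homology_class C D n z = (\<lambda>b. \<rho> n (b \<otimes>\<^bsub>C n\<^esub> z)) ` boundaries C D n"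
      by (auto simp: homology_class_def r_coset_def)
    also have "\<dots> = (\<lambda>b. \<rho> n b \<otimes>\<^bsub>C' n\<^esub> \<rho> n z) ` boundaries C D n"
      using that cyc_sub bd_sub by (intro image_cong refl mult) auto
    also have "\<dots> = homology_class C' D' n (\<rho> n z)"
      by (auto simp: homology_class_def r_coset_def bd_im)
    finally show ?thesis .
  qed
  then show "a \<in> cycles C D n \<Longrightarrow> \<rho> n ` homology_class C D n a = homology_class C' D' n (\<rho> n a)" .
  have carr: "carrier (homology C D n) = homology_class C D n ` cycles C D n"
    by (auto simp: homology_def FactGroup_def RCOSETS_def homology_class_def r_coset_def)
  have carr': "carrier (homology C' D' n) = homology_class C' D' n ` cycles C' D' n"
    by (auto simp: homology_def FactGroup_def RCOSETS_def homology_class_def r_coset_def)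
  have carr_sub: "S \<subseteq> carrier (C n)" if "S \<in> carrier (homology C D n)" for S
    using that class_sub by (auto simp: carr)
  \<comment> \<open>Classes are subsets of the carrier, where \<open>\<rho> n\<close> is injective,
    so distinct classes have distinct images.\<close>
  have "inj_on ((`) (\<rho> n)) (carrier (homology C D n))"
    using inj_on_image_eq_iff[OF inj[of n]] carr_sub by (intro inj_onI) blast
  moreover have "(`) (\<rho> n) ` carrier (homology C D n) = carrier (homology C' D' n)"
    unfolding carr carr' cyc_im image_image using class_im by (intro image_cong) auto
  moreover have "\<rho> n ` (S \<otimes>\<^bsub>homology C D n\<^esub> T) = \<rho> n ` S \<otimes>\<^bsub>homology C' D' n\<^esub> \<rho> n ` T"
    if "S \<in> carrier (homology C D n)" "T \<in> carrier (homology C D n)" for S T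
  proof -
    have "\<rho> n ` (S <#>\<^bsub>C n\<^esub> T) = \<rho> n ` S <#>\<^bsub>C' n\<^esub> \<rho> n ` T"
    proof -
      have "\<rho> n ` (S <#>\<^bsub>C n\<^esub> T) = (\<lambda>(x, y). \<rho> n (x \<otimes>\<^bsub>C n\<^esub> y)) ` (S \<times> T)"
        by (auto simp: set_mult_def)
      also have "\<dots> = (\<lambda>(x, y). \<rho> n x \<otimes>\<^bsub>C' n\<^esub> \<rho> n y) ` (S \<times> T)"
        using carr_sub[OF that(1)] carr_sub[OF that(2)] by (intro image_cong refl) (auto intro: mult)
      also have "\<dots> = \<rho> n ` S <#>\<^bsub>C' n\<^esub> \<rho> n ` T"
        by (auto simp: set_mult_def)
      finally show ?thesis .
    qed
    then show ?thesis
      by (simp add: homology_def FactGroup_def set_mult_def)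
  qed
  ultimately show "(`) (\<rho> n) \<in> iso (homology C D n) (homology C' D' n)"
    by (auto simp: iso_def hom_def bij_betw_def)
qed

section \<open>Controlled ultrafilters on tuples\<close>

locale bounded_geometry_space = Metric_space X d
  for X :: "'a set" and d :: "'a \<Rightarrow> 'a \<Rightarrow> real" +
  assumes bounded_geometry: "bounded_geometry X d"
begin

section \<open>Separating colourings and tuples of bounded diameter\<close>

definition separating :: "real \<Rightarrow> ('a \<Rightarrow> nat) \<Rightarrow> bool" where
  "separating r \<kappa> \<longleftrightarrow> finite (range \<kappa>) \<and>
    (\<forall>x\<in>X. \<forall>y\<in>X. d x y \<le> r \<longrightarrow> \<kappa> x = \<kappa> y \<longrightarrow> x = y)"

lemma ex_separating: "\<exists>\<kappa>. separating r \<kappa>"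
proof -
  define E where "E x y \<longleftrightarrow> x \<in> X \<and> y \<in> X \<and> d x y \<le> r" for x y
  \<comment> \<open>The radius \<open>\<bar>r\<bar> + 1\<close> is positive, as bounded geometry
    requires, and its open ball contains the closed ball of radius \<open>r\<close>.\<close>
  obtain N where N: "\<And>x. x \<in> X \<Longrightarrow> finite (mball x (\<bar>r\<bar> + 1)) \<and> card (mball x (\<bar>r\<bar> + 1)) \<le> N"
    using bounded_geometry unfolding bounded_geometry_def
    by (metis abs_ge_zero add_nonneg_pos zero_less_one)
  have "finite {y. E x y} \<and> card {y. E x y} \<le> N" for x
  proof (cases "x \<in> X")
    case True
    have "{y. E x y} \<subseteq> mball x (\<bar>r\<bar> + 1)"
      by (auto simp: E_def)
    with N[OF True] show ?thesis
      by (meson card_mono finite_subset order_trans)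
  qed (simp add: E_def)
  then obtain \<kappa> :: "'a \<Rightarrow> nat"
    where \<kappa>: "\<And>x. \<kappa> x \<le> N" "\<And>x y. E x y \<Longrightarrow> \<kappa> x = \<kappa> y \<Longrightarrow> x = y"
    using bounded_degree_colouring[of E N] by (auto simp: E_def commute)
  have "range \<kappa> \<subseteq> {..N}"
    using \<kappa>(1) by auto
  then have "finite (range \<kappa>)"
    using finite_subset by blast
  with \<kappa>(2) have "separating r \<kappa>"
    by (simp add: separating_def E_def)
  then show ?thesis
    by blast
qed

definition ctrl :: "nat \<Rightarrow> real \<Rightarrow> (nat \<Rightarrow> 'a) set" where
  "ctrl n r = {x \<in> tuples X n. \<forall>i\<le>n. \<forall>j\<le>n. d (x i) (x j) \<le> r}"

definition cultra :: "nat \<Rightarrow> (nat \<Rightarrow> 'a) filter set" where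
  "cultra n = {W. ultra W \<and> (\<exists>r. eventually (\<lambda>x. x \<in> ctrl n r) W)}"

definition marginal :: "nat \<Rightarrow> (nat \<Rightarrow> 'a) filter \<Rightarrow> 'a filter" where
  "marginal k W = filtermap (\<lambda>x. x k) W"

lemma eventually_marginal: "eventually P (marginal k W) \<longleftrightarrow> eventually (\<lambda>x. P (x k)) W"
  by (simp add: marginal_def eventually_filtermap)

lemma cultraD: "W \<in> cultra n \<Longrightarrow> ultra W"
  by (simp add: cultra_def)

lemma cultraE:
  assumes "W \<in> cultra n"
  obtains r where "eventually (\<lambda>x. x \<in> ctrl n r) W"
  using assms by (auto simp: cultra_def)

lemma ctrl_mono: "x \<in> ctrl n r \<Longrightarrow> r \<le> s \<Longrightarrow> x \<in> ctrl n s"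
  by (force simp: ctrl_def)

lemma ctrl_in: "x \<in> ctrl n r \<Longrightarrow> k \<le> n \<Longrightarrow> x k \<in> X"
  by (auto simp: ctrl_def tuples_def)

lemma ctrl_dist: "x \<in> ctrl n r \<Longrightarrow> i \<le> n \<Longrightarrow> j \<le> n \<Longrightarrow> d (x i) (x j) \<le> r"
  by (auto simp: ctrl_def)

lemma tuples_ext: "x \<in> tuples X n \<Longrightarrow> y \<in> tuples X n \<Longrightarrow> (\<And>k. k \<le> n \<Longrightarrow> x k = y k) \<Longrightarrow> x = y"
  unfolding tuples_def by (rule PiE_ext) auto

text \<open>The path from \<open>x k\<close> through \<open>x i = y i\<close> to \<open>y k\<close>
  has two legs of length at most \<open>r\<close>; hence the constant \<open>2 * r\<close> in all
  colourings.\<close>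

lemma ctrl_dist2:
  assumes "x \<in> ctrl n r" "y \<in> ctrl n r" "i \<le> n" "k \<le> n" "x i = y i"
  shows "d (x k) (y k) \<le> 2 * r"
  using ctrl_dist[OF assms(1), of k i] ctrl_dist[OF assms(2), of i k] assms
    triangle[of "x k" "x i" "y k"] ctrl_in by fastforce

lemma ctrl_eqI:
  assumes \<kappa>: "separating (2 * r) \<kappa>"
    and "x \<in> ctrl n r" "y \<in> ctrl n r" "i \<le> n" "x i = y i" "\<And>k. k \<le> n \<Longrightarrow> \<kappa> (x k) = \<kappa> (y k)"
  shows "x = y"
proof (rule tuples_ext)
  show "x \<in> tuples X n" "y \<in> tuples X n"
    using assms(2,3) by (auto simp: ctrl_def)
  fix k assume "k \<le> n"
  then show "x k = y k"
    using ctrl_dist2[OF assms(2-4) _ assms(5)] assms(2,3,6) \<kappa>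
    by (auto simp: ctrl_in separating_def)
qed

lemma ultra_marginal: "ultra W \<Longrightarrow> ultra (marginal k W)"
  by (simp add: marginal_def ultra_filtermap)

lemma marginal_in_ultrafilters:
  assumes "W \<in> cultra n" "k \<le> n"
  shows "marginal k W \<in> ultrafilters X"
proof -
  obtain r where "eventually (\<lambda>x. x \<in> ctrl n r) W"
    using assms by (rule_tac cultraE)
  then have "eventually (\<lambda>x. x k \<in> X) W"
    using ctrl_in assms(2) by (auto elim: eventually_mono)
  with cultraD[OF assms(1)] show ?thesis
    by (simp add: ultrafilters_iff ultra_marginal eventually_marginal)
qed

text \<open>The limiting colour pattern is computed from the marginals alone, so ultrafilters with
  equal marginals concentrate on the same colour piece.\<close>

lemma eventually_colour:
  assumes "separating r \<kappa>" "ultra W"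
  shows "eventually (\<lambda>x. \<forall>k\<le>n. \<kappa> (x k) = ulim \<kappa> (marginal k W)) W"
proof -
  have "finite (range \<kappa>)"
    using assms(1) by (simp add: separating_def)
  then have "eventually (\<lambda>x. \<kappa> (x k) = ulim \<kappa> (marginal k W)) W" for k
    using eventually_ulim[OF ultra_marginal[OF assms(2)], of \<kappa> k] by (simp add: eventually_marginal)
  then have "eventually (\<lambda>x. \<forall>k\<in>{..n}. \<kappa> (x k) = ulim \<kappa> (marginal k W)) W"
    by (intro eventually_ball_finite) auto
  then show ?thesis
    by (rule eventually_mono) auto
qed

lemma cultra_eqI:
  assumes W: "W \<in> cultra n" "W' \<in> cultra n"
    and eq: "\<And>k. k \<le> n \<Longrightarrow> marginal k W = marginal k W'"
  shows "W = W'"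
proof -
  obtain r1 r2 where r12: "eventually (\<lambda>x. x \<in> ctrl n r1) W" "eventually (\<lambda>x. x \<in> ctrl n r2) W'"
    using W by (auto simp: cultra_def)
  define r where "r = max r1 r2"
  have r: "eventually (\<lambda>x. x \<in> ctrl n r) W" "eventually (\<lambda>x. x \<in> ctrl n r) W'"
    using r12 by (auto elim!: eventually_mono simp: r_def elim: ctrl_mono)
  obtain \<kappa> where \<kappa>: "separating (2 * r) \<kappa>"
    using ex_separating by blast
  \<comment> \<open>The pattern of \<open>W\<close> serves both filters, since equal marginals give
    \<open>W'\<close> the same one. Coordinate 0 is then injective on a set charged by both.\<close>
  define T where "T = {x \<in> ctrl n r. \<forall>k\<le>n. \<kappa> (x k) = ulim \<kappa> (marginal k W)}"
  have "inj_on (\<lambda>x. x 0) T"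
    by (rule inj_onI, rule ctrl_eqI[OF \<kappa>, where i = 0]) (auto simp: T_def)
  moreover have "eventually (\<lambda>x. x \<in> T) W"
    using r(1) eventually_colour[OF \<kappa> cultraD[OF W(1)], of n]
    by eventually_elim (simp add: T_def)
  moreover have "eventually (\<lambda>x. x \<in> T) W'"
    using r(2) eventually_colour[OF \<kappa> cultraD[OF W(2)], of n]
    by eventually_elim (simp add: T_def eq)
  moreover have "filtermap (\<lambda>x. x 0) W = filtermap (\<lambda>x. x 0) W'"
    using eq[of 0] by (simp add: marginal_def)
  ultimately show ?thesis
    by (rule filter_eq_if_inj_on)
qed

section \<open>The topology of the coarse groupoid\<close>

text \<open>\<open>A\<close> need not lie in \<open>X\<close>, so that colour classes and images of
  sets of tuples can be inserted directly.\<close>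

definition sc_nbhd :: "'a set \<Rightarrow> 'a filter set" where
  "sc_nbhd A = {F \<in> ultrafilters X. eventually (\<lambda>x. x \<in> A) F}"

lemma openin_sc_nbhd: "openin (stone_cech X) (sc_nbhd A)"
proof -
  have "sc_nbhd A = {F \<in> ultrafilters X. eventually (\<lambda>x. x \<in> A \<inter> X) F}"
    by (auto simp: sc_nbhd_def ultrafilters_iff eventually_conj_iff)
  then show ?thesis
    unfolding stone_cech_def by (intro topology_generated_by_Basis image_eqI[where x = "A \<inter> X"]) auto
qed

text \<open>The generating sets are closed under finite intersections and hence form a base.\<close>

lemma openin_stone_cechD:
  assumes "openin (stone_cech X) U" "F \<in> U"
  shows "\<exists>A. F \<in> sc_nbhd A \<and> sc_nbhd A \<subseteq> U"
proof -
  have "generate_topology_on ((\<lambda>A. {F \<in> ultrafilters X. eventually (\<lambda>x. x \<in> A) F}) ` Pow X) U"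
    using assms(1) by (simp add: stone_cech_def openin_topology_generated_by)
  then show ?thesis
    using assms(2)
  proof induction
    case (Int U V)
    then obtain A B where "F \<in> sc_nbhd A" "sc_nbhd A \<subseteq> U" "F \<in> sc_nbhd B" "sc_nbhd B \<subseteq> V"
      by auto
    then have "F \<in> sc_nbhd (A \<inter> B) \<and> sc_nbhd (A \<inter> B) \<subseteq> U \<inter> V"
      by (auto simp: sc_nbhd_def eventually_conj_iff)
    then show ?case by blast
  next
    case (UN K)
    then show ?case by (meson Union_iff Union_upper order_trans)
  next
    case (Basis U)
    then show ?case unfolding sc_nbhd_def by auto
  qed simp
qed

section \<open>Entourages as marginals of ultrafilters on pairs\<close>

lemma sc_nbhd_marginal:
  "W \<in> cultra n \<Longrightarrow> k \<le> n \<Longrightarrow> marginal k W \<in> sc_nbhd A \<longleftrightarrow> eventually (\<lambda>x. x k \<in> A) W"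
  using marginal_in_ultrafilters by (auto simp: sc_nbhd_def eventually_marginal)

text \<open>A point of the closure has only product neighbourhoods that meet the pairs at distance
  at most \<open>r\<close>, so the pullbacks of \<open>u\<close> and \<open>v\<close> generate a
  proper filter together with \<open>ctrl 1 r\<close>. An ultrafilter below it has marginals below
  \<open>u\<close> and \<open>v\<close>, hence equal to them by minimality. Conversely, a product
  neighbourhood translates into a \<open>W\<close>-large set of pairs, any of which is the required
  nearby point.\<close>

lemma entourage_iff:
  "(u, v) \<in> coarse_entourage X d r \<longleftrightarrow>
    (\<exists>W. ultra W \<and> eventually (\<lambda>x. x \<in> ctrl 1 r) W \<and> u = marginal 0 W \<and> v = marginal 1 W)"
  (is "?L \<longleftrightarrow> ?R")
proof
  assume ?L
  then have L: "(u, v) \<in> prod_topology (stone_cech X) (stone_cech X) closure_of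
      {(sc_point x, sc_point y) | x y. x \<in> X \<and> y \<in> X \<and> d x y \<le> r}"
    by (simp add: coarse_entourage_def)
  then have uv: "u \<in> ultrafilters X" "v \<in> ultrafilters X"
    by (simp_all add: in_closure_of topspace_stone_cech)
  have cl: "\<forall>U. (u, v) \<in> U \<and> openin (prod_topology (stone_cech X) (stone_cech X)) U \<longrightarrow>
      (\<exists>p. p \<in> {(sc_point x, sc_point y) | x y. x \<in> X \<and> y \<in> X \<and> d x y \<le> r} \<and> p \<in> U)"
    using L unfolding in_closure_of by (rule conjunct2)
  define F where "F = inf (inf (filtercomap (\<lambda>x::nat \<Rightarrow> 'a. x 0) u) (filtercomap (\<lambda>x. x 1) v))
    (principal (ctrl 1 r))"
  have "F \<noteq> bot"
  proof
    assume "F = bot"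
    then have "eventually (\<lambda>x. False) F"
      by simp
    then obtain Q' R' where "eventually Q' (filtercomap (\<lambda>x::nat \<Rightarrow> 'a. x 0) u)"
        "eventually R' (filtercomap (\<lambda>x::nat \<Rightarrow> 'a. x 1) v)"
        and QR': "\<And>x. Q' x \<Longrightarrow> R' x \<Longrightarrow> x \<notin> ctrl 1 r"
      unfolding F_def eventually_inf_principal by (auto simp only: eventually_inf)
    then obtain Q R where QR: "eventually Q u" "\<And>x. Q (x 0) \<Longrightarrow> Q' x"
        "eventually R v" "\<And>x. R (x 1) \<Longrightarrow> R' x"
      unfolding eventually_filtercomap by auto
    then have no: "\<And>x. x \<in> ctrl 1 r \<Longrightarrow> Q (x 0) \<Longrightarrow> R (x 1) \<Longrightarrow> False"
      using QR' by blast
    have "(u, v) \<in> sc_nbhd (Collect Q) \<times> sc_nbhd (Collect R)"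
      using uv QR by (auto simp: sc_nbhd_def)
    moreover have "openin (prod_topology (stone_cech X) (stone_cech X))
        (sc_nbhd (Collect Q) \<times> sc_nbhd (Collect R))"
      by (simp add: openin_prod_Times_iff openin_sc_nbhd)
    ultimately obtain p where "p \<in> {(sc_point x, sc_point y) | x y. x \<in> X \<and> y \<in> X \<and> d x y \<le> r}"
        "p \<in> sc_nbhd (Collect Q) \<times> sc_nbhd (Collect R)"
      using cl by meson
    then obtain a b where
      ab: "sc_point a \<in> sc_nbhd (Collect Q)" "sc_point b \<in> sc_nbhd (Collect R)"
        "a \<in> X" "b \<in> X" "d a b \<le> r"
      by blast
    define x where "x = (\<lambda>j\<in>{..1::nat}. if j = 0 then a else b)"
    have "x \<in> ctrl 1 r"
      \<comment> \<open>The diameter condition with equal indices needs \<open>0 \<le> r\<close>,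
        which follows from \<open>d a b \<le> r\<close>.\<close>
      using ab(3-5) order_trans[OF nonneg[of a b] ab(5)] unfolding ctrl_def
      by (auto simp: x_def tuples_def le_Suc_eq commute order_trans)
    moreover have "Q (x 0)" "R (x 1)"
      using ab(1,2) by (auto simp: x_def sc_nbhd_def sc_point_def eventually_principal)
    ultimately show False
      using no by blast
  qed
  then obtain W where W: "ultra W" "W \<le> F"
    using ultra_exists by blast
  have "W \<le> filtercomap (\<lambda>x. x 0) u" "W \<le> filtercomap (\<lambda>x. x 1) v" "W \<le> principal (ctrl 1 r)"
    using W(2) by (auto simp: F_def)
  then have "marginal 0 W \<le> u" "marginal 1 W \<le> v" "eventually (\<lambda>x. x \<in> ctrl 1 r) W"
    by (auto simp: marginal_def filtermap_le_iff_le_filtercomap le_principal)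
  moreover have "marginal 0 W \<noteq> bot" "marginal 1 W \<noteq> bot"
    using ultra_not_bot[OF ultra_marginal[OF W(1)]] by auto
  moreover have "ultra u" "ultra v"
    using uv by (simp_all add: ultrafilters_iff)
  ultimately have "marginal 0 W = u" "marginal 1 W = v" "eventually (\<lambda>x. x \<in> ctrl 1 r) W"
    using ultra_le_eq by blast+
  with W(1) show ?R
    by blast
next
  assume ?R
  then obtain W where W: "ultra W" "eventually (\<lambda>x. x \<in> ctrl 1 r) W"
    and uv: "u = marginal 0 W" "v = marginal 1 W"
    by blast
  have Wc: "W \<in> cultra 1"
    using W by (auto simp: cultra_def)
  show ?L
    unfolding coarse_entourage_def in_closure_of
  proof (intro conjI allI impI)
    show "(u, v) \<in> topspace (prod_topology (stone_cech X) (stone_cech X))"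
      using marginal_in_ultrafilters[OF Wc] by (simp add: topspace_stone_cech uv)
    fix T assume T: "(u, v) \<in> T \<and> openin (prod_topology (stone_cech X) (stone_cech X)) T"
    then obtain U V where UV: "openin (stone_cech X) U" "openin (stone_cech X) V"
        "u \<in> U" "v \<in> V" "U \<times> V \<subseteq> T"
      unfolding openin_prod_topology_alt by meson
    obtain A where A: "u \<in> sc_nbhd A" "sc_nbhd A \<subseteq> U"
      using openin_stone_cechD[OF UV(1,3)] by blast
    obtain B where B: "v \<in> sc_nbhd B" "sc_nbhd B \<subseteq> V"
      using openin_stone_cechD[OF UV(2,4)] by blast
    note AB = A B
    then have "eventually (\<lambda>x. x 0 \<in> A) W" "eventually (\<lambda>x. x 1 \<in> B) W"
      using sc_nbhd_marginal[OF Wc] by (auto simp: uv)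
    with W(2) have "eventually (\<lambda>x. x \<in> ctrl 1 r \<and> x 0 \<in> A \<and> x 1 \<in> B) W"
      by eventually_elim blast
    then obtain x where x: "x \<in> ctrl 1 r" "x 0 \<in> A" "x 1 \<in> B"
      using ultra_exD[OF W(1)] by blast
    then have xX: "x 0 \<in> X" "x 1 \<in> X" "d (x 0) (x 1) \<le> r"
      using ctrl_in[of x 1] ctrl_dist[of x 1] by auto
    have "sc_point y \<in> ultrafilters X" if "y \<in> X" for y
      using sc_point_in_stone_cech[OF that] by (simp add: topspace_stone_cech)
    with x xX have "sc_point (x 0) \<in> sc_nbhd A" "sc_point (x 1) \<in> sc_nbhd B"
      by (auto simp: sc_nbhd_def sc_point_def eventually_principal)
    with AB UV(5) have "(sc_point (x 0), sc_point (x 1)) \<in> T"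
      by blast
    with xX show "\<exists>y. y \<in> {(sc_point x, sc_point y) |x y. x \<in> X \<and> y \<in> X \<and> d x y \<le> r} \<and> y \<in> T"
      by blast
  qed
qed

text \<open>On the colour piece charged by \<open>W\<close> the second coordinate is a function
  \<open>t\<close> of the first, so an arrow is the germ at \<open>u\<close> of a map moving points
  by at most \<open>r\<close>. Outside the projection of that piece \<open>t\<close> is
  arbitrary.\<close>

lemma entourage_graph:
  assumes "(u, v) \<in> coarse_entourage X d r"
  obtains t where "v = filtermap t u" "eventually (\<lambda>x. t x \<in> X \<and> d x (t x) \<le> r) u"
proof -
  obtain W where W: "ultra W" "eventually (\<lambda>x. x \<in> ctrl 1 r) W"
    and uv: "u = marginal 0 W" "v = marginal 1 W"
    using assms by (auto simp: entourage_iff)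
  obtain \<kappa> where \<kappa>: "separating (2 * r) \<kappa>"
    using ex_separating by blast
  define T where "T = {x \<in> ctrl 1 r. \<forall>k\<le>1. \<kappa> (x k) = ulim \<kappa> (marginal k W)}"
  have inj: "inj_on (\<lambda>x. x 0) T"
    by (rule inj_onI, rule ctrl_eqI[OF \<kappa>, where i = 0]) (auto simp: T_def)
  have T: "eventually (\<lambda>x. x \<in> T) W"
    using W(2) eventually_colour[OF \<kappa> W(1), of 1] by eventually_elim (simp add: T_def)
  define t where "t a = inv_into T (\<lambda>x. x 0) a 1" for a
  have t: "t (x 0) = x 1" if "x \<in> T" for x
    using inv_into_f_f[OF inj that] by (simp add: t_def)
  have "eventually P (filtermap t u) \<longleftrightarrow> eventually P v" for P
    unfolding uv eventually_filtermap eventually_marginal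
    by (rule eventually_subst[OF eventually_mono[OF T]]) (simp add: t)
  then have "v = filtermap t u"
    by (simp add: filter_eq_iff)
  moreover have "eventually (\<lambda>x. t x \<in> X \<and> d x (t x) \<le> r) u"
    unfolding uv eventually_marginal using T
    by eventually_elim (auto simp: t T_def ctrl_in ctrl_dist)
  ultimately show ?thesis
    by (rule that)
qed

text \<open>Induction on the length: the last arrow is the germ of a map \<open>t\<close>, and
  pushing \<open>W\<close> forward along the operation that appends \<open>t (x n)\<close> adds the
  new marginal. The diameter bound grows from \<open>r\<close> to \<open>r + s\<close>.\<close>

lemma cultra_realize:
  assumes "v 0 \<in> ultrafilters X"
    and "\<And>k. k < n \<Longrightarrow> \<exists>r. (v k, v (Suc k)) \<in> coarse_entourage X d r"
  shows "\<exists>W\<in>cultra n. \<forall>k\<le>n. marginal k W = v k"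
  using assms(2)
proof (induction n)
  case 0
  define W where "W = filtermap (\<lambda>x. \<lambda>j\<in>{..0::nat}. x) (v 0)"
  have "ultra W"
    using assms(1) by (simp add: W_def ultra_filtermap ultrafilters_iff)
  moreover have "eventually (\<lambda>x. x \<in> X) (v 0)"
    using assms(1) by (simp add: ultrafilters_iff)
  then have "eventually (\<lambda>x. x \<in> ctrl 0 0) W"
    unfolding W_def eventually_filtermap
    by eventually_elim (auto simp: ctrl_def tuples_def)
  ultimately have "W \<in> cultra 0"
    by (auto simp: cultra_def)
  moreover have "marginal 0 W = v 0"
    by (simp add: marginal_def W_def filtermap_filtermap)
  ultimately show ?case
    by auto
next
  case (Suc n)
  then obtain W where W: "W \<in> cultra n" "\<And>k. k \<le> n \<Longrightarrow> marginal k W = v k"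
    by auto
  obtain r where r: "eventually (\<lambda>x. x \<in> ctrl n r) W"
    using W(1) by (rule cultraE)
  obtain s where "(v n, v (Suc n)) \<in> coarse_entourage X d s"
    using Suc.prems by blast
  then obtain t where t: "v (Suc n) = filtermap t (v n)"
    and ts: "eventually (\<lambda>x. t x \<in> X \<and> d x (t x) \<le> s) (v n)"
    by (rule entourage_graph)
  define h where "h x = x(Suc n := t (x n))" for x :: "nat \<Rightarrow> 'a"
  have "eventually (\<lambda>x. t (x n) \<in> X \<and> d (x n) (t (x n)) \<le> s) W"
    using ts W(2)[of n] eventually_marginal[of _ n W] by simp
  with r have ev: "eventually (\<lambda>x. h x \<in> ctrl (Suc n) (r + s)) W"
  proof eventually_elim
    case (elim x)
    have x: "x \<in> ctrl n r" and s: "0 \<le> s" "t (x n) \<in> X" "d (x n) (t (x n)) \<le> s"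
      using elim nonneg[of "x n" "t (x n)"] by (auto simp del: nonneg)
    have r: "0 \<le> r"
      using ctrl_dist[OF x, of 0 0] nonneg[of "x 0" "x 0"] by linarith
    have close: "d (x i) (t (x n)) \<le> r + s" if "i \<le> n" for i
      using triangle[of "x i" "x n" "t (x n)"] ctrl_in[OF x] ctrl_dist[OF x that, of n] s that
      by fastforce
    have "h x \<in> tuples X (Suc n)"
      using x s(2) by (auto simp: ctrl_def tuples_def h_def PiE_iff extensional_def le_Suc_eq)
    moreover have "d (h x i) (h x j) \<le> r + s" if "i \<le> Suc n" "j \<le> Suc n" for i j
      using that close[of i] close[of j] ctrl_dist[OF x, of i j] s r mdist_zero[OF s(2)]
      by (auto simp: h_def le_Suc_eq commute)
    ultimately show ?case
      by (simp add: ctrl_def)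
  qed
  have "filtermap h W \<in> cultra (Suc n)"
    using cultraD[OF W(1)] ev by (auto simp: cultra_def ultra_filtermap eventually_filtermap)
  moreover have "marginal k (filtermap h W) = v k" if "k \<le> Suc n" for k
  proof (cases "k = Suc n")
    case True
    then show ?thesis
      using t W(2)[of n, symmetric] by (simp add: marginal_def filtermap_filtermap h_def)
  next
    case False
    with that W(2)[of k] show ?thesis
      by (simp add: marginal_def filtermap_filtermap h_def)
  qed
  ultimately show ?case
    by blast
qed

section \<open>The nerve\<close>

definition pair_at :: "nat \<Rightarrow> (nat \<Rightarrow> 'a) \<Rightarrow> nat \<Rightarrow> 'a" where
  "pair_at k x = (\<lambda>j\<in>{..1}. x (k + j))"

lemma pair_at_ctrl: "x \<in> ctrl n r \<Longrightarrow> Suc k \<le> n \<Longrightarrow> pair_at k x \<in> ctrl 1 r"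
  by (auto simp: ctrl_def tuples_def pair_at_def)

lemma pair_at_cultra:
  assumes "W \<in> cultra n" "Suc k \<le> n"
  shows "filtermap (pair_at k) W \<in> cultra 1"
proof -
  obtain r where "eventually (\<lambda>x. x \<in> ctrl n r) W"
    using assms(1) by (rule cultraE)
  then have "eventually (\<lambda>x. pair_at k x \<in> ctrl 1 r) W"
    by eventually_elim (rule pair_at_ctrl[OF _ assms(2)])
  with cultraD[OF assms(1)] show ?thesis
    unfolding cultra_def by (auto simp: ultra_filtermap eventually_filtermap)
qed

lemma marginal_pair_at:
  "marginal 0 (filtermap (pair_at k) W) = marginal k W"
  "marginal 1 (filtermap (pair_at k) W) = marginal (Suc k) W"
  by (simp_all add: marginal_def filtermap_filtermap pair_at_def)

text \<open>A witness \<open>V\<close> for the left side has the same marginals as the image of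
  \<open>W\<close> under \<open>pair_at k\<close>, so the two agree by \<open>cultra_eqI\<close>.
  Membership in an entourage can thus be tested on \<open>W\<close> itself.\<close>

lemma entourage_marginal_iff:
  assumes "W \<in> cultra n" "Suc k \<le> n"
  shows "(marginal k W, marginal (Suc k) W) \<in> coarse_entourage X d r \<longleftrightarrow>
    eventually (\<lambda>x. d (x k) (x (Suc k)) \<le> r) W" (is "?L \<longleftrightarrow> ?R")
proof
  assume ?L
  then obtain V where V: "ultra V" "eventually (\<lambda>x. x \<in> ctrl 1 r) V"
    and m: "marginal k W = marginal 0 V" "marginal (Suc k) W = marginal 1 V"
    by (auto simp: entourage_iff)
  have "V = filtermap (pair_at k) W"
  proof (rule cultra_eqI)
    show "V \<in> cultra 1" "filtermap (pair_at k) W \<in> cultra 1"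
      using V pair_at_cultra[OF assms] by (auto simp: cultra_def)
    fix i :: nat assume "i \<le> 1"
    then show "marginal i V = marginal i (filtermap (pair_at k) W)"
      using m by (auto simp: le_Suc_eq marginal_pair_at[unfolded One_nat_def])
  qed
  with V(2) have "eventually (\<lambda>x. pair_at k x \<in> ctrl 1 r) W"
    by (simp add: eventually_filtermap)
  then show ?R
    by eventually_elim (drule ctrl_dist[of _ _ _ 0 1], auto simp: pair_at_def)
next
  assume R: ?R
  obtain s where "eventually (\<lambda>x. x \<in> ctrl n s) W"
    using assms(1) by (rule cultraE)
  with R have "eventually (\<lambda>x. pair_at k x \<in> ctrl 1 r) W"
  proof eventually_elim
    case (elim x)
    then show ?case
      using ctrl_in[of x n s k] ctrl_in[of x n s "Suc k"] assms(2)
        order_trans[OF nonneg[of "x k" "x (Suc k)"] elim(1)]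
      by (auto simp: ctrl_def pair_at_def tuples_def le_Suc_eq commute)
  qed
  then show ?L
    unfolding entourage_iff
    using pair_at_cultra[OF assms, THEN cultraD] marginal_pair_at[of k W]
    by (intro exI[of _ "filtermap (pair_at k) W"]) (simp add: eventually_filtermap)
qed

lemma entourage_marginal:
  assumes "W \<in> cultra n" "Suc k \<le> n"
  obtains r where "r > 0" "(marginal k W, marginal (Suc k) W) \<in> coarse_entourage X d r"
proof -
  obtain s where "eventually (\<lambda>x. x \<in> ctrl n s) W"
    using assms(1) by (rule cultraE)
  \<comment> \<open>The maximum with 1 makes the radius positive, since the arrow space is a union
    over positive radii.\<close>
  then have "eventually (\<lambda>x. d (x k) (x (Suc k)) \<le> max s 1) W"
    by eventually_elim (use assms(2) in \<open>auto simp: ctrl_def le_max_iff_disj\<close>)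
  then show ?thesis
    using that[of "max s 1"] entourage_marginal_iff[OF assms] by auto
qed

lemma entourage_subset: "coarse_entourage X d r \<subseteq> ultrafilters X \<times> ultrafilters X"
  unfolding coarse_entourage_def
  by (rule order_trans[OF closure_of_subset_topspace]) (simp add: topspace_stone_cech)

definition string :: "nat \<Rightarrow> (nat \<Rightarrow> 'a) filter \<Rightarrow> 'a filter + (nat \<Rightarrow> 'a filter \<times> 'a filter)" where
  "string n W =
    (if n = 0 then Inl (marginal 0 W)
     else Inr (\<lambda>k\<in>{1..n}. (marginal (k - 1) W, marginal k W)))"

text \<open>By composability the source of one arrow is the range of the next, so these
  \<open>n + 1\<close> objects determine a string in the nerve.\<close>

definition vertex :: "nat \<Rightarrow> nat \<Rightarrow> 'a filter + (nat \<Rightarrow> 'a filter \<times> 'a filter) \<Rightarrow> 'a filter" where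
  "vertex n k p =
    (if n = 0 then projl p else if k = 0 then fst (projr p 1) else snd (projr p k))"

lemma tuple_string_eq: "tuple_string n x = string n (principal {x})"
  by (simp add: tuple_string_def string_def marginal_def sc_point_def)

lemma vertex_string: "k \<le> n \<Longrightarrow> vertex n k (string n W) = marginal k W"
  by (auto simp: vertex_def string_def)

abbreviation \<G> where "\<G> \<equiv> coarse_groupoid X d"

lemma topspace_nerve_0: "topspace (nerve \<G> 0) = Inl ` ultrafilters X"
  by (auto simp: nerve_def topspace_pullback_topology coarse_groupoid_def topspace_stone_cech)

lemma topspace_nerve_Suc:
  "topspace (nerve \<G> (Suc n)) = Inr ` {g \<in> (\<Pi>\<^sub>E i\<in>{1..Suc n}. topspace (coarse_arrows X d)).
     \<forall>i. 1 \<le> i \<and> i < Suc n \<longrightarrow> snd (g i) = fst (g (Suc i))}"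
  by (auto simp: nerve_def topspace_pullback_topology coarse_groupoid_def)

lemma string_in_nerve:
  assumes "W \<in> cultra n"
  shows "string n W \<in> topspace (nerve \<G> n)"
proof (cases n)
  case 0
  then show ?thesis
    using marginal_in_ultrafilters[OF assms, of 0] by (simp add: topspace_nerve_0 string_def)
next
  case (Suc m)
  have "(marginal (k - 1) W, marginal k W) \<in> topspace (coarse_arrows X d)" if "k \<in> {1..n}" for k
    using that entourage_marginal[OF assms, of "k - 1"] by (auto simp: topspace_coarse_arrows)
  then show ?thesis
    unfolding Suc topspace_nerve_Suc string_def
    by (auto simp: Suc)
qed

lemma nerve_string:
  assumes "p \<in> topspace (nerve \<G> n)"
  shows "\<exists>W\<in>cultra n. string n W = p"
proof (cases n)
  case 0
  with assms obtain u where u: "p = Inl u" "u \<in> ultrafilters X"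
    by (auto simp: topspace_nerve_0)
  then obtain W where "W \<in> cultra 0" "\<forall>k\<le>0. marginal k W = u"
    using cultra_realize[of "\<lambda>_. u" 0] by auto
  with 0 u show ?thesis
    by (auto simp: string_def)
next
  case (Suc m)
  with assms obtain g where g: "p = Inr g" "g \<in> (\<Pi>\<^sub>E i\<in>{1..n}. topspace (coarse_arrows X d))"
      "\<And>i. 1 \<le> i \<Longrightarrow> i < n \<Longrightarrow> snd (g i) = fst (g (Suc i))"
    using topspace_nerve_Suc[of m] by auto
  define v where "v k = vertex n k p" for k
  \<comment> \<open>For \<open>k > 1\<close> the first component is the source of the preceding
    arrow.\<close>
  have v: "g k = (v (k - 1), v k)" if "k \<in> {1..n}" for k
  proof (cases "k = 1")
    case True
    then show ?thesis
      using Suc by (simp add: v_def vertex_def g(1))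
  next
    case False
    then show ?thesis
      using Suc that g(3)[of "k - 1"] by (auto simp: v_def vertex_def g(1) prod_eq_iff)
  qed
  have ent: "\<exists>r. (v k, v (Suc k)) \<in> coarse_entourage X d r" if "k < n" for k
    using PiE_mem[OF g(2), of "Suc k"] v[of "Suc k"] that by (auto simp: topspace_coarse_arrows)
  then have "v 0 \<in> ultrafilters X"
    using entourage_subset Suc by blast
  then obtain W where W: "W \<in> cultra n" "\<forall>k\<le>n. marginal k W = v k"
    using cultra_realize[of v n] ent by blast
  have "(\<lambda>k\<in>{1..n}. (marginal (k - 1) W, marginal k W)) = g"
  proof
    fix k show "(\<lambda>k\<in>{1..n}. (marginal (k - 1) W, marginal k W)) k = g k"
    proof (cases "k \<in> {1..n}")
      case True
      then show ?thesis
        using W(2) v[OF True] by auto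
    next
      case False
      then show ?thesis
        using PiE_arb[OF g(2) False] by (auto simp: restrict_def)
    qed
  qed
  with W(1) Suc show ?thesis
    by (auto simp: string_def g(1))
qed

lemma inj_on_string: "inj_on (string n) (cultra n)"
proof (rule inj_onI)
  fix V W assume VW: "V \<in> cultra n" "W \<in> cultra n" "string n V = string n W"
  then show "V = W"
    using vertex_string[of _ n V] vertex_string[of _ n W] by (intro cultra_eqI) auto
qed

text \<open>The topology inherited from the Stone-Cech compactification of the discrete set of
  tuples: the ultrafilters charging a set \<open>T\<close> form a basic open set.\<close>

definition cultra_top :: "nat \<Rightarrow> (nat \<Rightarrow> 'a) filter topology" where
  "cultra_top n = topology (\<lambda>U. U \<subseteq> cultra n \<and>
    (\<forall>W\<in>U. \<exists>T. eventually (\<lambda>x. x \<in> T) W \<and> (\<forall>V\<in>cultra n. eventually (\<lambda>x. x \<in> T) V \<longrightarrow> V \<in> U)))"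

lemma openin_cultra_top:
  "openin (cultra_top n) U \<longleftrightarrow> U \<subseteq> cultra n \<and>
    (\<forall>W\<in>U. \<exists>T. eventually (\<lambda>x. x \<in> T) W \<and> (\<forall>V\<in>cultra n. eventually (\<lambda>x. x \<in> T) V \<longrightarrow> V \<in> U))"
proof -
  define P where "P U W \<longleftrightarrow> (\<exists>T. eventually (\<lambda>x. x \<in> T) W \<and>
    (\<forall>V\<in>cultra n. eventually (\<lambda>x. x \<in> T) V \<longrightarrow> V \<in> U))" for U W
  have "P (U \<inter> V) W" if UV: "P U W" "P V W" for U V W
  proof -
    obtain S T where "eventually (\<lambda>x. x \<in> S) W" "\<forall>F\<in>cultra n. eventually (\<lambda>x. x \<in> S) F \<longrightarrow> F \<in> U"
      "eventually (\<lambda>x. x \<in> T) W" "\<forall>F\<in>cultra n. eventually (\<lambda>x. x \<in> T) F \<longrightarrow> F \<in> V"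
      using UV unfolding P_def by blast
    then show ?thesis
      unfolding P_def by (intro exI[of _ "S \<inter> T"]) (auto simp: eventually_conj_iff)
  qed
  moreover have "P (\<Union>K) W" if "U \<in> K" "P U W" for K U W
    using that unfolding P_def by blast
  ultimately have "istopology (\<lambda>U. U \<subseteq> cultra n \<and> (\<forall>W\<in>U. P U W))"
    unfolding istopology_def by blast
  then show ?thesis
    unfolding cultra_top_def P_def by (simp only: topology_inverse')
qed

lemma topspace_cultra_top [simp]: "topspace (cultra_top n) = cultra n"
proof
  show "topspace (cultra_top n) \<subseteq> cultra n"
    using openin_cultra_top openin_topspace by meson
  have "openin (cultra_top n) (cultra n)"
    unfolding openin_cultra_top by (auto intro: exI[of _ UNIV])
  then show "cultra n \<subseteq> topspace (cultra_top n)"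
    by (rule openin_subset)
qed

section \<open>Continuity of the comparison map from controlled ultrafilters to the nerve\<close>

lemma continuous_marginal:
  assumes "k \<le> n"
  shows "continuous_map (cultra_top n) (stone_cech X) (marginal k)"
  unfolding continuous_map_def
proof (intro conjI allI impI)
  show "marginal k \<in> topspace (cultra_top n) \<rightarrow> topspace (stone_cech X)"
    using marginal_in_ultrafilters[OF _ assms] by (auto simp: topspace_stone_cech)
  fix U assume U: "openin (stone_cech X) U"
  show "openin (cultra_top n) {W \<in> topspace (cultra_top n). marginal k W \<in> U}"
    unfolding openin_cultra_top
  proof (intro conjI ballI)
    fix W assume "W \<in> {W \<in> topspace (cultra_top n). marginal k W \<in> U}"
    then have W: "W \<in> cultra n" "marginal k W \<in> U"
      by auto
    obtain A where A: "marginal k W \<in> sc_nbhd A" "sc_nbhd A \<subseteq> U"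
      using openin_stone_cechD[OF U W(2)] by blast
    show "\<exists>T. eventually (\<lambda>x. x \<in> T) W \<and> (\<forall>V\<in>cultra n. eventually (\<lambda>x. x \<in> T) V \<longrightarrow>
        V \<in> {W \<in> topspace (cultra_top n). marginal k W \<in> U})"
      using A sc_nbhd_marginal[OF _ assms] W(1) by (intro exI[of _ "{x. x k \<in> A}"]) auto
  qed auto
qed

lemma continuous_arrow:
  assumes "Suc k \<le> n"
  shows "continuous_map (cultra_top n) (coarse_arrows X d) (\<lambda>W. (marginal k W, marginal (Suc k) W))"
  unfolding continuous_map_def
proof (intro conjI allI impI)
  let ?f = "\<lambda>W. (marginal k W, marginal (Suc k) W)"
  let ?P = "prod_topology (stone_cech X) (stone_cech X)"
  show "?f \<in> topspace (cultra_top n) \<rightarrow> topspace (coarse_arrows X d)"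
  proof
    fix W assume "W \<in> topspace (cultra_top n)"
    then have "W \<in> cultra n"
      by simp
    from entourage_marginal[OF this assms] show "?f W \<in> topspace (coarse_arrows X d)"
      unfolding topspace_coarse_arrows by blast
  qed
  fix U assume U: "openin (coarse_arrows X d) U"
  show "openin (cultra_top n) {W \<in> topspace (cultra_top n). ?f W \<in> U}"
    unfolding openin_cultra_top
  proof (intro conjI ballI)
    fix W assume "W \<in> {W \<in> topspace (cultra_top n). ?f W \<in> U}"
    then have W: "W \<in> cultra n" "?f W \<in> U"
      by auto
    obtain r where r: "r > 0" "?f W \<in> coarse_entourage X d r"
      using entourage_marginal[OF W(1) assms] by blast
    have "openin (subtopology ?P (coarse_entourage X d r)) (U \<inter> coarse_entourage X d r)"
      using U r(1) by (simp add: openin_coarse_arrows)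
    then obtain Q where Q: "openin ?P Q" "U \<inter> coarse_entourage X d r = Q \<inter> coarse_entourage X d r"
      by (auto simp: openin_subtopology)
    then have "?f W \<in> Q"
      using W(2) r(2) by blast
    then obtain U1 U2 where U12: "openin (stone_cech X) U1" "openin (stone_cech X) U2"
        "marginal k W \<in> U1" "marginal (Suc k) W \<in> U2" "U1 \<times> U2 \<subseteq> Q"
      using Q(1) unfolding openin_prod_topology_alt by metis
    obtain A where A: "marginal k W \<in> sc_nbhd A" "sc_nbhd A \<subseteq> U1"
      using openin_stone_cechD[OF U12(1,3)] by blast
    obtain B where B: "marginal (Suc k) W \<in> sc_nbhd B" "sc_nbhd B \<subseteq> U2"
      using openin_stone_cechD[OF U12(2,4)] by blast
    \<comment> \<open>\<open>U\<close> is a trace of a product-open set only inside one entourage.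
      The distance condition keeps nearby ultrafilters in that entourage.\<close>
    let ?T = "{x. x k \<in> A \<and> x (Suc k) \<in> B \<and> d (x k) (x (Suc k)) \<le> r}"
    have T: "eventually (\<lambda>x. x \<in> ?T) V \<longleftrightarrow> marginal k V \<in> sc_nbhd A \<and>
        marginal (Suc k) V \<in> sc_nbhd B \<and> ?f V \<in> coarse_entourage X d r" if "V \<in> cultra n" for V
      using that assms entourage_marginal_iff[OF that assms]
      by (simp add: eventually_conj_iff sc_nbhd_marginal)
    show "\<exists>T. eventually (\<lambda>x. x \<in> T) W \<and> (\<forall>V\<in>cultra n. eventually (\<lambda>x. x \<in> T) V \<longrightarrow>
        V \<in> {W \<in> topspace (cultra_top n). ?f W \<in> U})"
    proof (intro exI[of _ ?T] conjI ballI impI)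
      show "eventually (\<lambda>x. x \<in> ?T) W"
        using T[OF W(1)] A(1) B(1) r(2) by blast
      fix V assume V: "V \<in> cultra n" "eventually (\<lambda>x. x \<in> ?T) V"
      then have "?f V \<in> Q \<inter> coarse_entourage X d r"
        using T[OF V(1)] A(2) B(2) U12(5) by blast
      with Q(2) V(1) show "V \<in> {W \<in> topspace (cultra_top n). ?f W \<in> U}"
        by auto
    qed
  qed auto
qed

lemma continuous_string: "continuous_map (cultra_top n) (nerve \<G> n) (string n)"
proof (cases "n = 0")
  case True
  have "projl \<circ> string 0 = marginal 0"
    by (auto simp: string_def)
  then show ?thesis
    unfolding True nerve_def using continuous_marginal[of 0 0]
    by (auto intro!: continuous_map_pullback' simp: coarse_groupoid_def string_def)
next
  case False
  let ?g = "\<lambda>W. \<lambda>k\<in>{1..n}. (marginal (k - 1) W, marginal k W)"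
  have pr: "projr \<circ> string n = ?g"
    using False by (auto simp: string_def fun_eq_iff)
  have "continuous_map (cultra_top n) (product_topology (\<lambda>_. coarse_arrows X d) {1..n}) ?g"
    unfolding continuous_map_componentwise
  proof (intro conjI ballI)
    fix k assume k: "k \<in> {1..n}"
    then show "continuous_map (cultra_top n) (coarse_arrows X d) (\<lambda>W. ?g W k)"
      using continuous_arrow[of "k - 1" n] by simp
  qed auto
  then have "continuous_map (cultra_top n) (subtopology
      (product_topology (\<lambda>_. coarse_arrows X d) {1..n})
      {g. \<forall>i. 1 \<le> i \<and> i < n \<longrightarrow> snd (g i) = fst (g (Suc i))}) (projr \<circ> string n)"
    unfolding pr by (auto simp: continuous_map_in_subtopology)
  then show ?thesis
    unfolding nerve_def using False
    by (auto intro!: continuous_map_pullback' simp: coarse_groupoid_def string_def)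
qed

text \<open>Inside another entourage of radius \<open>s\<close>, a neighbourhood of an arrow is cut
  out by two conditions: the first coordinate lies in the projection of \<open>T\<close> and the
  second has colour \<open>C\<close>. A pair in \<open>ctrl 1 s\<close> satisfying both shares its
  first coordinate with a pair in \<open>T\<close>, and a colouring at scale
  \<open>2 * max r s\<close> forces them to be equal.\<close>

lemma openin_entourage:
  assumes "r > 0"
  shows "openin (coarse_arrows X d) (coarse_entourage X d r)"
  unfolding openin_coarse_arrows
proof (intro conjI allI impI)
  let ?E = "coarse_entourage X d" and ?P = "prod_topology (stone_cech X) (stone_cech X)"
  show "?E r \<subseteq> (\<Union>r\<in>{0<..}. ?E r)"
    using assms by blast
  fix s :: real
  show "openin (subtopology ?P (?E s)) (?E r \<inter> ?E s)"
  proof (subst openin_subopen, intro ballI)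
    fix p assume p: "p \<in> ?E r \<inter> ?E s"
    obtain u v where uv: "p = (u, v)"
      by fastforce
    obtain W where W: "ultra W" "eventually (\<lambda>x. x \<in> ctrl 1 r) W"
      and m: "u = marginal 0 W" "v = marginal 1 W"
      using p by (auto simp: entourage_iff uv)
    have Wc: "W \<in> cultra 1"
      using W by (auto simp: cultra_def)
    obtain \<kappa> where \<kappa>: "separating (2 * max r s) \<kappa>"
      using ex_separating by blast
    define C where "C = ulim \<kappa> v"
    define T where "T = {x \<in> ctrl 1 r. \<kappa> (x 1) = C}"
    have evC: "eventually (\<lambda>x. \<kappa> (x 1) = C) W"
      using eventually_colour[OF \<kappa> W(1), of 1] by eventually_elim (simp add: C_def m)
    have evT: "eventually (\<lambda>x. x \<in> T) W"
      using W(2) evC by eventually_elim (simp add: T_def)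
    let ?Q = "sc_nbhd ((\<lambda>x. x 0) ` T) \<times> sc_nbhd {a. \<kappa> a = C}"
    have "openin ?P ?Q"
      by (simp add: openin_prod_Times_iff openin_sc_nbhd)
    moreover have "p \<in> ?Q"
      using evC evT sc_nbhd_marginal[OF Wc] by (auto simp: uv m elim: eventually_mono)
    moreover have "?Q \<inter> ?E s \<subseteq> ?E r"
    proof
      fix q assume q: "q \<in> ?Q \<inter> ?E s"
      obtain u' v' where uv': "q = (u', v')"
        by fastforce
      obtain V where V: "ultra V" "eventually (\<lambda>x. x \<in> ctrl 1 s) V"
        and m': "u' = marginal 0 V" "v' = marginal 1 V"
        using q by (auto simp: entourage_iff uv')
      have Vc: "V \<in> cultra 1"
        using V by (auto simp: cultra_def)
      have "eventually (\<lambda>x. x 0 \<in> (\<lambda>x. x 0) ` T) V" "eventually (\<lambda>x. \<kappa> (x 1) = C) V"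
        using q sc_nbhd_marginal[OF Vc] by (auto simp: uv' m')
      with V(2) have "eventually (\<lambda>x. x \<in> ctrl 1 r) V"
      proof eventually_elim
        case (elim x)
        then obtain y where y: "y \<in> T" "x 0 = y 0"
          by auto
        have "x = y"
        proof (rule ctrl_eqI[OF \<kappa>, of _ 1 _ 0])
          show "x \<in> ctrl 1 (max r s)" "y \<in> ctrl 1 (max r s)"
            using elim y by (auto simp: T_def elim: ctrl_mono)
          fix k :: nat assume "k \<le> 1"
          then show "\<kappa> (x k) = \<kappa> (y k)"
            using elim y by (auto simp: T_def le_Suc_eq)
        qed (use y in auto)
        with y show ?case
          by (simp add: T_def)
      qed
      with V(1) m' show "q \<in> ?E r"
        by (auto simp: entourage_iff uv')
    qed
    ultimately show "\<exists>T. openin (subtopology ?P (?E s)) T \<and> p \<in> T \<and> T \<subseteq> ?E r \<inter> ?E s"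
      using p by (intro exI[of _ "?Q \<inter> ?E s"]) (auto simp: openin_subtopology)
  qed
qed

section \<open>Openness of the comparison map\<close>

lemma continuous_arrow_fst: "continuous_map (coarse_arrows X d) (stone_cech X) fst"
  and continuous_arrow_snd: "continuous_map (coarse_arrows X d) (stone_cech X) snd"
proof -
  let ?E = "coarse_entourage X d" and ?P = "prod_topology (stone_cech X) (stone_cech X)"
  have "continuous_map (coarse_arrows X d) (stone_cech X) f"
    if f: "continuous_map ?P (stone_cech X) f" for f
    unfolding continuous_map_def
  proof (intro conjI allI impI)
    have sub: "topspace (coarse_arrows X d) \<subseteq> topspace ?P"
      using entourage_subset by (auto simp: topspace_coarse_arrows topspace_stone_cech)
    with f show "f \<in> topspace (coarse_arrows X d) \<rightarrow> topspace (stone_cech X)"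
      unfolding continuous_map_def by blast
    fix U assume U: "openin (stone_cech X) U"
    have "openin (subtopology ?P (?E r)) ({p \<in> topspace (coarse_arrows X d). f p \<in> U} \<inter> ?E r)"
      if "r > 0" for r
    proof -
      have "{p \<in> topspace (coarse_arrows X d). f p \<in> U} \<inter> ?E r = {p \<in> topspace ?P. f p \<in> U} \<inter> ?E r"
        using sub that by (auto simp: topspace_coarse_arrows)
      moreover have "openin ?P {p \<in> topspace ?P. f p \<in> U}"
        using f U by (rule openin_continuous_map_preimage)
      ultimately show ?thesis
        unfolding openin_subtopology by blast
    qed
    then show "openin (coarse_arrows X d) {p \<in> topspace (coarse_arrows X d). f p \<in> U}"
      unfolding openin_coarse_arrows by (auto simp: topspace_coarse_arrows)
  qed
  then show "continuous_map (coarse_arrows X d) (stone_cech X) fst"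
    "continuous_map (coarse_arrows X d) (stone_cech X) snd"
    using continuous_map_fst continuous_map_snd by blast+
qed

lemma continuous_nerve_arrow:
  assumes "k \<in> {1..n}"
  shows "continuous_map (nerve \<G> n) (coarse_arrows X d) (\<lambda>p. projr p k)"
proof -
  have "continuous_map (subtopology (product_topology (\<lambda>_. coarse_arrows X d) {1..n})
      {g. \<forall>i. 1 \<le> i \<and> i < n \<longrightarrow> snd (g i) = fst (g (Suc i))}) (coarse_arrows X d) (\<lambda>g. g k)"
    using assms by (intro continuous_map_from_subtopology continuous_map_product_projection)
  from continuous_map_pullback[OF this, of "range Inr" projr] show ?thesis
    using assms by (auto simp: nerve_def coarse_groupoid_def o_def)
qed

lemma continuous_vertex:
  assumes "k \<le> n"
  shows "continuous_map (nerve \<G> n) (stone_cech X) (vertex n k)"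
proof (cases "n = 0")
  case True
  then show ?thesis
    using continuous_map_pullback[OF continuous_map_id, where A = "range Inl" and f = projl]
    by (simp add: nerve_def coarse_groupoid_def vertex_def[abs_def] o_def)
next
  case False
  then show ?thesis
    using continuous_map_compose[OF continuous_nerve_arrow[of 1 n] continuous_arrow_fst]
      continuous_map_compose[OF continuous_nerve_arrow[of k n] continuous_arrow_snd] assms
    by (auto simp: vertex_def[abs_def] o_def)
qed

text \<open>Walking from vertex 0 reaches every vertex within \<open>n * r\<close>; comparing two
  vertices through vertex 0 gives the factor 2.\<close>

lemma chain_ctrl:
  assumes "x \<in> tuples X n" "\<And>k. Suc k \<le> n \<Longrightarrow> d (x k) (x (Suc k)) \<le> r"
  shows "x \<in> ctrl n (2 * (real n * r))"
proof -
  have X: "x k \<in> X" if "k \<le> n" for k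
    using assms(1) that by (auto simp: tuples_def)
  have d0: "d (x 0) (x k) \<le> real k * r" if "k \<le> n" for k
    using that
  proof (induction k)
    case (Suc k)
    then show ?case
      using triangle[of "x 0" "x k" "x (Suc k)"] assms(2)[of k] X by (fastforce simp: algebra_simps)
  qed (use X[of 0] in simp)
  \<comment> \<open>For \<open>n = 0\<close> nothing forces \<open>0 \<le> r\<close>, but then
    \<open>k = 0\<close> as well.\<close>
  have "real k * r \<le> real n * r" if "k \<le> n" for k
  proof (cases "n = 0")
    case False
    then have "0 \<le> r"
      using order_trans[OF nonneg assms(2)[of 0]] by simp
    with that show ?thesis
      by (intro mult_right_mono) auto
  qed (use that in simp)
  with d0 have d1: "d (x 0) (x k) \<le> real n * r" if "k \<le> n" for k
    using that order_trans by blast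
  have "d (x i) (x j) \<le> 2 * (real n * r)" if "i \<le> n" "j \<le> n" for i j
    using triangle''[of "x i" "x 0" "x j"] X[of 0] X[of i] X[of j] d1[of i] d1[of j] that
    by linarith
  with assms(1) show ?thesis
    by (simp add: ctrl_def)
qed

text \<open>Near \<open>string n W\<close>, the conditions defining \<open>Q\<close> concern single
  vertices and single arrows: vertex 0 lies over \<open>S\<close>, all vertices have the colours
  seen by \<open>W\<close>, and all arrows have length at most \<open>s\<close>. A tuple meeting
  them agrees at vertex 0 with a member of \<open>S\<close>, and the colours force equality.\<close>

lemma openin_nerve_basic:
  assumes T: "T \<subseteq> ctrl n r"
  shows "openin (nerve \<G> n) (string n ` {W \<in> cultra n. eventually (\<lambda>x. x \<in> T) W})"
proof (subst openin_subopen, intro ballI)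
  fix p assume "p \<in> string n ` {W \<in> cultra n. eventually (\<lambda>x. x \<in> T) W}"
  then obtain W where W: "W \<in> cultra n" "eventually (\<lambda>x. x \<in> T) W" and p: "p = string n W"
    by auto
  define s where "s = max r 1"
  have s: "s > 0" "T \<subseteq> ctrl n s"
    using T ctrl_mono[of _ n r s] by (auto simp: s_def)
  \<comment> \<open>A common control radius: \<open>s\<close> for the members of \<open>T\<close>,
    and the bound of \<open>chain_ctrl\<close> for tuples whose consecutive distances are at most
    \<open>s\<close>.\<close>
  define R where "R = max s (2 * (real n * s))"
  obtain \<kappa> where \<kappa>: "separating (2 * R) \<kappa>"
    using ex_separating by blast
  define C where "C k = ulim \<kappa> (marginal k W)" for k
  have evC: "eventually (\<lambda>x. \<forall>k\<le>n. \<kappa> (x k) = C k) W"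
    unfolding C_def by (rule eventually_colour[OF \<kappa> cultraD[OF W(1)]])
  define S where "S = {x \<in> T. \<forall>k\<le>n. \<kappa> (x k) = C k}"
  have evS: "eventually (\<lambda>x. x \<in> S) W"
    using W(2) evC by eventually_elim (simp add: S_def)
  have nb: "openin (nerve \<G> n) {q \<in> topspace (nerve \<G> n). vertex n k q \<in> sc_nbhd A}"
    if "k \<le> n" for k A
    using continuous_vertex[OF that] openin_sc_nbhd by (rule openin_continuous_map_preimage)
  define Q0 where "Q0 = {q \<in> topspace (nerve \<G> n). vertex n 0 q \<in> sc_nbhd ((\<lambda>x. x 0) ` S)}"
  define Q1 where "Q1 k = {q \<in> topspace (nerve \<G> n). vertex n k q \<in> sc_nbhd {a. \<kappa> a = C k}}" for k
  define Q2 where "Q2 k = {q \<in> topspace (nerve \<G> n). projr q k \<in> coarse_entourage X d s}" for k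
  \<comment> \<open>For \<open>n = 0\<close> the last intersection is over an empty family; meeting
    it with the whole space keeps it open.\<close>
  define Q where "Q = Q0 \<inter> (\<Inter>k\<in>{..n}. Q1 k) \<inter> (topspace (nerve \<G> n) \<inter> (\<Inter>k\<in>{1..n}. Q2 k))"
  have "openin (nerve \<G> n) (Q2 k)" if "k \<in> {1..n}" for k
    unfolding Q2_def using continuous_nerve_arrow[OF that] openin_entourage[OF s(1)]
    by (rule openin_continuous_map_preimage)
  then have "openin (nerve \<G> n) (topspace (nerve \<G> n) \<inter> (\<Inter>k\<in>{1..n}. Q2 k))"
    by (cases "n = 0") (auto intro!: openin_Int openin_INT2)
  moreover have "openin (nerve \<G> n) Q0"
    unfolding Q0_def by (rule nb) simp
  moreover have "openin (nerve \<G> n) (\<Inter>k\<in>{..n}. Q1 k)"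
    unfolding Q1_def by (rule openin_INT2) (auto intro: nb)
  ultimately have "openin (nerve \<G> n) Q"
    unfolding Q_def using openin_Int by blast
  moreover have Qiff: "string n V \<in> Q \<longleftrightarrow> eventually (\<lambda>x. x 0 \<in> (\<lambda>x. x 0) ` S) V \<and>
      (\<forall>k\<le>n. eventually (\<lambda>x. \<kappa> (x k) = C k) V) \<and>
      (\<forall>k. Suc k \<le> n \<longrightarrow> eventually (\<lambda>x. d (x k) (x (Suc k)) \<le> s) V)" if V: "V \<in> cultra n" for V
  proof -
    have "(\<forall>k\<in>{1..n}. string n V \<in> Q2 k) \<longleftrightarrow>
        (\<forall>k. Suc k \<le> n \<longrightarrow> (marginal k V, marginal (Suc k) V) \<in> coarse_entourage X d s)"
    proof -
      have "string n V \<in> Q2 (Suc k) \<longleftrightarrow>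
          (marginal k V, marginal (Suc k) V) \<in> coarse_entourage X d s" if "Suc k \<le> n" for k
        using that string_in_nerve[OF V] by (auto simp: Q2_def string_def)
      moreover have "(\<forall>k\<in>{1..n}. string n V \<in> Q2 k) \<longleftrightarrow>
          (\<forall>k. Suc k \<le> n \<longrightarrow> string n V \<in> Q2 (Suc k))"
        by (auto simp: Ball_def) (metis Suc_le_D One_nat_def)
      ultimately show ?thesis
        by simp
    qed
    then show ?thesis
      using string_in_nerve[OF V] entourage_marginal_iff[OF V] sc_nbhd_marginal[OF V]
      by (simp add: Q_def Q0_def Q1_def vertex_string flip: atMost_iff)
        (simp add: Ball_def vertex_string)
  qed
  have "p \<in> Q"
    unfolding p Qiff[OF W(1)]
  proof (intro conjI allI impI)
    show "eventually (\<lambda>x. x 0 \<in> (\<lambda>x. x 0) ` S) W"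
      using evS by eventually_elim blast
    show "eventually (\<lambda>x. \<kappa> (x k) = C k) W" if "k \<le> n" for k
      using evC by eventually_elim (simp add: that)
    show "eventually (\<lambda>x. d (x k) (x (Suc k)) \<le> s) W" if "Suc k \<le> n" for k
      using W(2) by eventually_elim (use s(2) that ctrl_dist in auto)
  qed
  moreover have "Q \<subseteq> string n ` {W \<in> cultra n. eventually (\<lambda>x. x \<in> T) W}"
  proof
    fix q assume q: "q \<in> Q"
    then obtain V where V: "V \<in> cultra n" "q = string n V"
      using nerve_string[of q n] by (auto simp: Q_def)
    then have ev: "eventually (\<lambda>x. x 0 \<in> (\<lambda>x. x 0) ` S) V"
        "eventually (\<lambda>x. \<forall>k\<in>{..n}. \<kappa> (x k) = C k) V"
        "eventually (\<lambda>x. \<forall>k\<in>{..<n}. d (x k) (x (Suc k)) \<le> s) V"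
      using q Qiff[OF V(1)] by (auto simp: eventually_ball_finite_distrib)
    \<comment> \<open>This radius only certifies that \<open>x\<close> is a tuple; its control at a
      known radius comes from \<open>chain_ctrl\<close>.\<close>
    obtain t where "eventually (\<lambda>x. x \<in> ctrl n t) V"
      using V(1) by (rule cultraE)
    with ev have "eventually (\<lambda>x. x \<in> T) V"
    proof eventually_elim
      case (elim x)
      then obtain y where y: "y \<in> S" "x 0 = y 0"
        by auto
      have "x \<in> ctrl n (2 * (real n * s))"
        using elim(3,4) by (intro chain_ctrl) (auto simp: ctrl_def)
      then have "x \<in> ctrl n R"
        by (rule ctrl_mono) (simp add: R_def)
      moreover have "y \<in> ctrl n R"
        using y s(2) by (auto simp: S_def R_def intro: ctrl_mono)
      ultimately have "x = y"
        using y elim(2) by (intro ctrl_eqI[OF \<kappa>, of _ n _ 0]) (auto simp: S_def)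
      with y show ?case
        by (simp add: S_def)
    qed
    with V show "q \<in> string n ` {W \<in> cultra n. eventually (\<lambda>x. x \<in> T) W}"
      by blast
  qed
  ultimately show "\<exists>Q. openin (nerve \<G> n) Q \<and> p \<in> Q \<and>
      Q \<subseteq> string n ` {W \<in> cultra n. eventually (\<lambda>x. x \<in> T) W}"
    by blast
qed

text \<open>If no finite part of \<open>\<S>\<close> covers \<open>T\<close>, some ultrafilter
  charges \<open>T\<close> and avoids every member of \<open>\<S>\<close>. Charging \<open>T\<close>
  makes it controlled, so it lies in a member of the cover and charges a set in \<open>\<S>\<close>,
  a contradiction.\<close>

lemma compactin_cultra_basic:
  assumes T: "T \<subseteq> ctrl n r"
  shows "compactin (cultra_top n) {W \<in> cultra n. eventually (\<lambda>x. x \<in> T) W}"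
  unfolding compactin_def
proof (intro conjI allI impI)
  show "{W \<in> cultra n. eventually (\<lambda>x. x \<in> T) W} \<subseteq> topspace (cultra_top n)"
    by auto
  fix \<U> assume \<U>: "(\<forall>U\<in>\<U>. openin (cultra_top n) U) \<and>
    {W \<in> cultra n. eventually (\<lambda>x. x \<in> T) W} \<subseteq> \<Union>\<U>"
  define \<S> where "\<S> = {S. \<exists>U\<in>\<U>. \<forall>V\<in>cultra n. eventually (\<lambda>x. x \<in> S) V \<longrightarrow> V \<in> U}"
  have "\<exists>K\<subseteq>\<S>. finite K \<and> T \<subseteq> \<Union>K"
  proof (rule ccontr)
    assume no: "\<not> (\<exists>K\<subseteq>\<S>. finite K \<and> T \<subseteq> \<Union>K)"
    \<comment> \<open>Inserting \<open>- T\<close> puts \<open>T\<close> itself into every filter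
      below \<open>F\<close>.\<close>
    define F where "F = (INF S\<in>insert (- T) \<S>. principal (- S))"
    have "F \<noteq> bot"
      unfolding F_def
    proof (rule INF_filter_not_bot)
      fix K assume K: "K \<subseteq> insert (- T) \<S>" "finite K"
      have "(INF S\<in>K. principal (- S)) = principal (\<Inter>S\<in>K. - S)"
        by (rule INF_principal_finite[OF K(2)])
      moreover have "\<not> T \<subseteq> \<Union>(K - {- T})"
        using no K by (metis Diff_subset_conv finite_Diff insert_is_Un)
      then have "(\<Inter>S\<in>K. - S) \<noteq> {}"
        by blast
      ultimately show "(INF S\<in>K. principal (- S)) \<noteq> bot"
        by (simp add: principal_eq_bot_iff)
    qed
    then obtain W where W: "ultra W" "W \<le> F"
      using ultra_exists by blast
    then have ev: "eventually (\<lambda>x. x \<notin> S) W" if "S \<in> insert (- T) \<S>" for S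
    proof -
      have "W \<le> principal (- S)"
        using order_trans[OF W(2)] that unfolding F_def by (meson INF_lower)
      then show ?thesis
        by (simp add: le_principal)
    qed
    have evT: "eventually (\<lambda>x. x \<in> T) W"
      using ev[of "- T"] by simp
    then have "eventually (\<lambda>x. x \<in> ctrl n r) W"
      by eventually_elim (use T in blast)
    with W(1) have "W \<in> cultra n"
      by (auto simp: cultra_def)
    with evT \<U> obtain U where U: "U \<in> \<U>" "W \<in> U"
      by blast
    with \<U> obtain S where S: "eventually (\<lambda>x. x \<in> S) W"
        "\<forall>V\<in>cultra n. eventually (\<lambda>x. x \<in> S) V \<longrightarrow> V \<in> U"
      unfolding openin_cultra_top by meson
    then have "S \<in> \<S>"
      using U by (auto simp: \<S>_def)
    with ev[of S] S(1) ultra_Not[OF W(1)] show False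
      by auto
  qed
  then obtain K where K: "K \<subseteq> \<S>" "finite K" "T \<subseteq> \<Union>K"
    by blast
  from K(1) obtain f where f: "\<And>S. S \<in> K \<Longrightarrow> f S \<in> \<U>"
      "\<And>S V. S \<in> K \<Longrightarrow> V \<in> cultra n \<Longrightarrow> eventually (\<lambda>x. x \<in> S) V \<Longrightarrow> V \<in> f S"
    unfolding \<S>_def by (simp add: subset_iff) metis
  have "{W \<in> cultra n. eventually (\<lambda>x. x \<in> T) W} \<subseteq> \<Union>(f ` K)"
  proof
    fix W assume "W \<in> {W \<in> cultra n. eventually (\<lambda>x. x \<in> T) W}"
    then have W: "W \<in> cultra n" "eventually (\<lambda>x. x \<in> T) W"
      by auto
    from W(2) have "eventually (\<lambda>x. \<exists>S\<in>K. x \<in> S) W"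
      by eventually_elim (use K(3) in blast)
    then show "W \<in> \<Union>(f ` K)"
      using ultra_ex_finite[OF cultraD[OF W(1)] K(2), of "\<lambda>S x. x \<in> S"] f(2)[OF _ W(1)] by blast
  qed
  then show "\<exists>\<F>. finite \<F> \<and> \<F> \<subseteq> \<U> \<and> {W \<in> cultra n. eventually (\<lambda>x. x \<in> T) W} \<subseteq> \<Union>\<F>"
    using K(2) f(1) by (intro exI[of _ "f ` K"]) auto
qed

lemma compactin_nerve_basic:
  assumes "T \<subseteq> ctrl n r"
  shows "compactin (nerve \<G> n) (string n ` {W \<in> cultra n. eventually (\<lambda>x. x \<in> T) W})"
  using compactin_cultra_basic[OF assms] continuous_string by (rule image_compactin)

section \<open>Chains of the coarse groupoid\<close>

definition cont_ext :: "nat \<Rightarrow> ((nat \<Rightarrow> 'a) \<Rightarrow> int) \<Rightarrow> 'a filter + (nat \<Rightarrow> 'a filter \<times> 'a filter) \<Rightarrow> int" where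
  "cont_ext n c p =
    (if p \<in> topspace (nerve \<G> n) then ulim c (the_inv_into (cultra n) (string n) p) else 0)"

lemma cont_ext_string: "W \<in> cultra n \<Longrightarrow> cont_ext n c (string n W) = ulim c W"
  by (simp add: cont_ext_def string_in_nerve the_inv_into_f_f[OF inj_on_string])

lemma uf_chainsD:
  assumes "c \<in> uf_chains X d n"
  shows "\<exists>B r. (\<forall>x. \<bar>c x\<bar> \<le> B) \<and> finite (range c) \<and> (\<forall>x. c x \<noteq> 0 \<longrightarrow> x \<in> ctrl n r)"
proof -
  obtain B r where B: "\<And>x. \<bar>c x\<bar> \<le> B" and "\<And>x. c x \<noteq> 0 \<Longrightarrow> x \<in> ctrl n r"
    using assms unfolding uf_chains_def ctrl_def by blast
  moreover have "range c \<subseteq> {-B..B}"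
    using B by (auto simp: abs_le_iff minus_le_iff)
  then have "finite (range c)"
    using finite_subset by blast
  ultimately show ?thesis
    by blast
qed

lemma uf_chainsI:
  assumes "\<And>x. c x \<noteq> 0 \<Longrightarrow> x \<in> ctrl n r" "\<And>x. \<bar>c x\<bar> \<le> B"
  shows "c \<in> uf_chains X d n"
proof -
  have "c x \<noteq> 0 \<Longrightarrow> x \<in> ctrl n (max r 1)" for x
    using assms(1) ctrl_mono by fastforce
  moreover have "max r 1 > 0"
    by simp
  ultimately show ?thesis
    using assms(2) unfolding uf_chains_def ctrl_def by blast
qed

text \<open>The fibre sums of \<open>ulim_pushforward\<close> range over all ultrafilters; this
  shows that only points of the nerve contribute.\<close>

lemma ulim_nonzero_cultra:
  assumes "c \<in> uf_chains X d n" "ultra W" "ulim c W \<noteq> 0"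
  shows "W \<in> cultra n"
proof -
  obtain B r where "\<And>x. \<bar>c x\<bar> \<le> B" and r: "finite (range c)" "\<And>x. c x \<noteq> 0 \<Longrightarrow> x \<in> ctrl n r"
    using uf_chainsD[OF assms(1)] by blast
  then have "eventually (\<lambda>x. c x \<noteq> 0) W"
    using ulim_nonzero[OF assms(2)] assms(3) by blast
  then have "eventually (\<lambda>x. x \<in> ctrl n r) W"
    by eventually_elim (rule r)
  with assms(2) show ?thesis
    by (auto simp: cultra_def)
qed

lemma principal_cultra:
  assumes "x \<in> tuples X n"
  shows "principal {x} \<in> cultra n"
proof -
  \<comment> \<open>A single tuple is always controlled; the sum of its consecutive distances is a
    uniform bound for each of them.\<close>
  have "d (x k) (x (Suc k)) \<le> (\<Sum>j<n. d (x j) (x (Suc j)))" if "Suc k \<le> n" for k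
    using that by (intro member_le_sum) auto
  from chain_ctrl[OF assms this] show ?thesis
    by (auto simp: cultra_def ultra_principal eventually_principal)
qed

lemma restrict_chain_tuple:
  "x \<in> tuples X n \<Longrightarrow> restrict_chain X n a x = a (string n (principal {x}))"
  by (simp add: restrict_chain_def tuple_string_eq)

text \<open>The extension is locally constant: it takes the value \<open>ulim c W\<close> at every
  ultrafilter charging the set where \<open>c\<close> has that value. Intersecting with
  \<open>ctrl n r\<close> makes this set admissible for \<open>openin_nerve_basic\<close>.\<close>

lemma continuous_cont_ext:
  assumes c: "c \<in> uf_chains X d n"
  shows "continuous_map (nerve \<G> n) (discrete_topology UNIV) (cont_ext n c)"
  unfolding continuous_map_def
proof (intro conjI allI impI)
  have fin: "finite (range c)"
    using uf_chainsD[OF c] by blast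
  fix U :: "int set"
  let ?S = "{p \<in> topspace (nerve \<G> n). cont_ext n c p \<in> U}"
  show "openin (nerve \<G> n) ?S"
  proof (subst openin_subopen, intro ballI)
    fix p assume p: "p \<in> ?S"
    then obtain W where W: "W \<in> cultra n" "p = string n W"
      using nerve_string by blast
    obtain r where r: "eventually (\<lambda>x. x \<in> ctrl n r) W"
      using W(1) by (rule cultraE)
    define T where "T = {x \<in> ctrl n r. c x = ulim c W}"
    let ?O = "string n ` {V \<in> cultra n. eventually (\<lambda>x. x \<in> T) V}"
    have "openin (nerve \<G> n) ?O"
      by (rule openin_nerve_basic[of _ _ r]) (auto simp: T_def)
    moreover have "eventually (\<lambda>x. x \<in> T) W"
      using r eventually_ulim[OF cultraD[OF W(1)] fin] by eventually_elim (simp add: T_def)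
    then have "p \<in> ?O"
      using W by blast
    moreover have "string n V \<in> ?S" if V: "V \<in> cultra n" "eventually (\<lambda>x. x \<in> T) V" for V
    proof -
      have "ulim c V = ulim c W"
        using V by (intro ulim_eqI cultraD[OF V(1)]) (auto simp: T_def elim: eventually_mono)
      then show ?thesis
        using p W V(1) by (simp add: cont_ext_string string_in_nerve)
    qed
    then have "?O \<subseteq> ?S"
      by blast
    ultimately show "\<exists>Q. openin (nerve \<G> n) Q \<and> p \<in> Q \<and> Q \<subseteq> ?S"
      by blast
  qed
qed auto

text \<open>The set where the extension is nonzero is the image of the ultrafilters charging the
  support of \<open>c\<close>. It is compact, and it is closed by continuity, so the closure adds
  nothing.\<close>

lemma cont_ext_Cc_int:
  assumes c: "c \<in> uf_chains X d n"
  shows "cont_ext n c \<in> Cc_int (nerve \<G> n)"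
proof -
  let ?N = "nerve \<G> n" and ?S = "{p \<in> topspace (nerve \<G> n). cont_ext n c p \<noteq> 0}"
  obtain B r where "\<And>x. \<bar>c x\<bar> \<le> B" and r: "finite (range c)" "\<And>x. c x \<noteq> 0 \<Longrightarrow> x \<in> ctrl n r"
    using uf_chainsD[OF c] by blast
  have "?S = string n ` {W \<in> cultra n. eventually (\<lambda>x. x \<in> {x. c x \<noteq> 0}) W}"
  proof -
    have "ulim c W = 0 \<longleftrightarrow> \<not> eventually (\<lambda>x. c x \<noteq> 0) W" if "W \<in> cultra n" for W
      using ulim_nonzero[OF cultraD[OF that] r(1)] by blast
    then show ?thesis
      by (auto simp: cont_ext_string string_in_nerve dest!: nerve_string)
  qed
  then have "compactin ?N ?S"
    using compactin_nerve_basic[of "{x. c x \<noteq> 0}" n r] r(2) by auto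
  moreover have "closedin ?N {p \<in> topspace ?N. cont_ext n c p \<in> - {0}}"
    using continuous_cont_ext[OF c] by (rule closedin_continuous_map_preimage) simp
  then have "?N closure_of ?S = ?S"
    by (simp add: closure_of_closedin)
  ultimately show ?thesis
    using continuous_cont_ext[OF c] by (auto simp: Cc_int_def cont_ext_def)
qed

lemma restrict_chain_uf:
  assumes a: "a \<in> Cc_int (nerve \<G> n)"
  shows "restrict_chain X n a \<in> uf_chains X d n"
proof -
  let ?N = "nerve \<G> n"
  define K where "K = ?N closure_of {p \<in> topspace ?N. a p \<noteq> 0}"
  have K: "compactin ?N K" and cont: "continuous_map ?N (discrete_topology UNIV) a"
    and zero: "\<And>p. p \<notin> topspace ?N \<Longrightarrow> a p = 0"
    using a by (auto simp: Cc_int_def K_def)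
  have inK: "p \<in> K" if "a p \<noteq> 0" for p
    using that zero closure_of_subset[of "{p \<in> topspace ?N. a p \<noteq> 0}" ?N] by (auto simp: K_def)
  \<comment> \<open>An open exhaustion of the nerve by diameter; a compact support needs only
    finitely many members.\<close>
  define U where "U m = string n ` {W \<in> cultra n. eventually (\<lambda>x. x \<in> ctrl n (real m)) W}" for m :: nat
  have "K \<subseteq> \<Union>(range U)"
  proof
    fix p assume "p \<in> K"
    then obtain W where W: "W \<in> cultra n" "p = string n W"
      using nerve_string compactin_subset_topspace[OF K] by blast
    obtain r where r: "eventually (\<lambda>x. x \<in> ctrl n r) W"
      using W(1) by (rule cultraE)
    obtain m where "r \<le> real m"
      using real_arch_simple by blast
    with r have "eventually (\<lambda>x. x \<in> ctrl n (real m)) W"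
      by (auto elim: eventually_mono ctrl_mono)
    with W show "p \<in> \<Union>(range U)"
      by (auto simp: U_def)
  qed
  moreover have "openin ?N (U m)" for m
    unfolding U_def by (rule openin_nerve_basic) (rule order_refl)
  ultimately obtain \<F> where "finite \<F>" "\<F> \<subseteq> range U" "K \<subseteq> \<Union>\<F>"
    using compactinD[OF K, of "range U"] by blast
  then obtain M where M: "finite M" "K \<subseteq> \<Union>(U ` M)"
    by (metis finite_subset_image)
  \<comment> \<open>The sum over \<open>M\<close> serves as an upper bound of its members and makes
    sense for empty \<open>M\<close>.\<close>
  have supp: "x \<in> ctrl n (real (\<Sum>M))" if "restrict_chain X n a x \<noteq> 0" for x
  proof -
    have x: "x \<in> tuples X n" "a (string n (principal {x})) \<noteq> 0"
      using that by (auto simp: restrict_chain_def tuple_string_eq split: if_splits)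
    then obtain m where m: "m \<in> M" "string n (principal {x}) \<in> U m"
      using M(2) inK by blast
    then obtain W where W: "W \<in> cultra n" "eventually (\<lambda>x. x \<in> ctrl n (real m)) W"
        "string n (principal {x}) = string n W"
      unfolding U_def by blast
    then have "W = principal {x}"
      using inj_on_string principal_cultra[OF x(1)] by (metis inj_onD)
    then have "x \<in> ctrl n (real m)"
      using W(2) by (simp add: eventually_principal)
    moreover have "real m \<le> real (\<Sum>M)"
      using member_le_sum[OF m(1), of "\<lambda>m. m"] M(1) by (intro of_nat_mono) simp
    ultimately show ?thesis
      by (rule ctrl_mono)
  qed
  \<comment> \<open>A compact subset of the discrete integers is finite, which bounds the
    chain.\<close>
  have "finite (a ` K)"
    using image_compactin[OF K cont] by (simp add: compactin_discrete_topology)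
  then have "\<bar>restrict_chain X n a x\<bar> \<le> (\<Sum>v\<in>a ` K. \<bar>v\<bar>)" for x
  proof (cases "restrict_chain X n a x = 0")
    case False
    then have "restrict_chain X n a x = a (tuple_string n x)" "a (tuple_string n x) \<noteq> 0"
      by (simp_all add: restrict_chain_def split: if_splits)
    then have "restrict_chain X n a x \<in> a ` K"
      using inK[of "tuple_string n x"] by simp
    then show ?thesis
      using \<open>finite (a ` K)\<close> by (intro member_le_sum) auto
  qed (simp add: sum_nonneg)
  with supp show ?thesis
    by (rule uf_chainsI)
qed

lemma restrict_cont_ext:
  assumes "c \<in> uf_chains X d n"
  shows "restrict_chain X n (cont_ext n c) = c"
proof
  fix x
  have "x \<notin> tuples X n \<Longrightarrow> c x = 0"
    using assms by (auto simp: uf_chains_def)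
  then show "restrict_chain X n (cont_ext n c) x = c x"
    by (cases "x \<in> tuples X n")
      (simp_all add: restrict_chain_tuple cont_ext_string principal_cultra, simp add: restrict_chain_def)
qed

text \<open>Points of \<open>X\<close> are dense: \<open>a\<close> is constant on a neighbourhood of
  \<open>string n W\<close>, so its values at the principal ultrafilters of \<open>W\<close>-almost
  all tuples equal its value there.\<close>

lemma cont_ext_restrict:
  assumes a: "a \<in> Cc_int (nerve \<G> n)"
  shows "cont_ext n (restrict_chain X n a) = a"
proof
  fix p
  let ?N = "nerve \<G> n"
  have cont: "continuous_map ?N (discrete_topology UNIV) a"
    and zero: "p \<notin> topspace ?N \<Longrightarrow> a p = 0"
    using a by (auto simp: Cc_int_def)
  show "cont_ext n (restrict_chain X n a) p = a p"
  proof (cases "p \<in> topspace ?N")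
    case True
    then obtain W where W: "W \<in> cultra n" "p = string n W"
      using nerve_string by blast
    have "continuous_map (cultra_top n) (discrete_topology UNIV) (a \<circ> string n)"
      using continuous_string cont by (rule continuous_map_compose)
    then have "openin (cultra_top n) {V \<in> topspace (cultra_top n). (a \<circ> string n) V \<in> {a p}}"
      by (rule openin_continuous_map_preimage) simp
    then have "openin (cultra_top n) {V \<in> cultra n. a (string n V) = a p}"
      by simp
    moreover have "W \<in> {V \<in> cultra n. a (string n V) = a p}"
      using W by simp
    ultimately obtain T where T: "eventually (\<lambda>x. x \<in> T) W"
        "\<And>V. V \<in> cultra n \<Longrightarrow> eventually (\<lambda>x. x \<in> T) V \<Longrightarrow> a (string n V) = a p"
      unfolding openin_cultra_top by blast
    obtain r where r: "eventually (\<lambda>x. x \<in> ctrl n r) W"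
      using W(1) by (rule cultraE)
    have "eventually (\<lambda>x. restrict_chain X n a x = a p) W"
      using T(1) r
    proof eventually_elim
      case (elim x)
      then have "x \<in> tuples X n"
        by (simp add: ctrl_def)
      then show ?case
        using T(2)[OF principal_cultra] elim(1)
        by (simp add: restrict_chain_tuple eventually_principal)
    qed
    then show ?thesis
      unfolding W(2) cont_ext_string[OF W(1)] by (rule ulim_eqI[OF cultraD[OF W(1)]])
  next
    case False
    with zero show ?thesis
      by (simp add: cont_ext_def)
  qed
qed

section \<open>Restriction as an isomorphism of chain groups\<close>

lemma bij_betw_restrict_chain:
  "bij_betw (restrict_chain X n) (Cc_int (nerve \<G> n)) (uf_chains X d n)"
  by (rule bij_betw_byWitness[where f' = "cont_ext n"])
    (auto simp: cont_ext_restrict restrict_cont_ext cont_ext_Cc_int restrict_chain_uf)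

text \<open>The factor \<open>k\<close> covers both addition and the signs of the alternating
  boundary sum.\<close>

lemma uf_chains_lin:
  assumes a: "a \<in> uf_chains X d n" and b: "b \<in> uf_chains X d n"
  shows "(\<lambda>x. a x + k * b x) \<in> uf_chains X d n"
proof -
  obtain A r where A: "\<And>x. \<bar>a x\<bar> \<le> A" "finite (range a)" "\<And>x. a x \<noteq> 0 \<Longrightarrow> x \<in> ctrl n r"
    using uf_chainsD[OF a] by blast
  obtain B s where B: "\<And>x. \<bar>b x\<bar> \<le> B" "finite (range b)" "\<And>x. b x \<noteq> 0 \<Longrightarrow> x \<in> ctrl n s"
    using uf_chainsD[OF b] by blast
  show ?thesis
  proof (rule uf_chainsI)
    fix x
    have "\<bar>k * b x\<bar> \<le> \<bar>k\<bar> * B"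
      using B(1)[of x] by (simp add: abs_mult mult_left_mono)
    then show "\<bar>a x + k * b x\<bar> \<le> A + \<bar>k\<bar> * B"
      using A(1)[of x] by linarith
    assume "a x + k * b x \<noteq> 0"
    then have "a x \<noteq> 0 \<or> b x \<noteq> 0"
      by auto
    then show "x \<in> ctrl n (max r s)"
      using A(3)[of x] B(3)[of x] ctrl_mono[of x n _ "max r s"] by auto
  qed
qed

lemma cont_ext_lin:
  assumes a: "a \<in> uf_chains X d n" and b: "b \<in> uf_chains X d n"
  shows "cont_ext n (\<lambda>x. a x + k * b x) p = cont_ext n a p + k * cont_ext n b p"
proof (cases "p \<in> topspace (nerve \<G> n)")
  case True
  then obtain W where W: "W \<in> cultra n" "p = string n W"
    using nerve_string by blast
  have fin: "finite (range a)" "finite (range b)"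
    using uf_chainsD[OF a] uf_chainsD[OF b] by blast+
  have "eventually (\<lambda>x. a x + k * b x = ulim a W + k * ulim b W) W"
    using eventually_ulim[OF cultraD[OF W(1)] fin(1)] eventually_ulim[OF cultraD[OF W(1)] fin(2)]
    by eventually_elim simp
  then show ?thesis
    unfolding W(2) cont_ext_string[OF W(1)] by (rule ulim_eqI[OF cultraD[OF W(1)]])
qed (simp add: cont_ext_def)

lemmas uf_chains_add = uf_chains_lin[where k = 1, simplified]
  and cont_ext_add = cont_ext_lin[where k = 1, simplified]

lemma uf_chains_zero: "(\<lambda>_. 0) \<in> uf_chains X d n"
  by (rule uf_chainsI[of _ _ 0 0]) auto

lemma Cc_int_zero: "(\<lambda>_. 0) \<in> Cc_int Y"
  by (simp add: Cc_int_def)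

lemma cont_ext_zero: "cont_ext n (\<lambda>_. 0) = (\<lambda>_. 0)"
proof -
  have "restrict_chain X n (\<lambda>_. 0) = (\<lambda>_. 0)"
    by (simp add: restrict_chain_def)
  then show ?thesis
    using cont_ext_restrict[OF Cc_int_zero, of n] by simp
qed

text \<open>Closure under addition is carried over from uniformly finite chains through the
  bijection.\<close>

lemma Cc_int_add:
  assumes "a \<in> Cc_int (nerve \<G> n)" "b \<in> Cc_int (nerve \<G> n)"
  shows "(\<lambda>x. a x + b x) \<in> Cc_int (nerve \<G> n)"
proof -
  let ?a = "restrict_chain X n a" and ?b = "restrict_chain X n b"
  have "cont_ext n (\<lambda>x. ?a x + ?b x) \<in> Cc_int (nerve \<G> n)"
    using assms by (intro cont_ext_Cc_int uf_chains_add restrict_chain_uf)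
  moreover have "cont_ext n (\<lambda>x. ?a x + ?b x) = (\<lambda>x. a x + b x)"
    using assms by (simp add: cont_ext_add restrict_chain_uf cont_ext_restrict fun_eq_iff)
  ultimately show ?thesis
    by simp
qed

lemma monoid_uf_complex: "monoid (uf_complex X d n)"
  by unfold_locales
    (auto simp: uf_complex_def int_fun_group_def uf_chains_zero uf_chains_add add.assoc)

lemma monoid_groupoid_complex: "monoid (groupoid_complex \<G> n)"
  by unfold_locales
    (auto simp: groupoid_complex_def int_fun_group_def Cc_int_zero Cc_int_add add.assoc)

lemma restrict_chain_iso: "restrict_chain X n \<in> iso (groupoid_complex \<G> n) (uf_complex X d n)"
  using bij_betw_restrict_chain[of n] restrict_chain_uf
  by (auto simp: iso_def hom_def groupoid_complex_def uf_complex_def int_fun_group_def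
      restrict_chain_def)

section \<open>The boundary maps\<close>

lemma marginal_omit:
  "k < n \<Longrightarrow> marginal k (filtermap (omit n i) W) = marginal (if k < i then k else Suc k) W"
  by (simp add: marginal_def filtermap_filtermap omit_def)

text \<open>In a pair groupoid, composing the two arrows at vertex \<open>i\<close> deletes that
  vertex; the outer faces drop an end vertex. For \<open>m = 0\<close> the faces are objects, hence
  the case split.\<close>

lemma nerve_face_string:
  assumes "i \<le> Suc m"
  shows "nerve_face \<G> (Suc m) i (string (Suc m) W) = string m (filtermap (omit (Suc m) i) W)"
proof (cases "m = 0")
  case True
  with assms show ?thesis
    by (auto simp: nerve_face_def string_def coarse_groupoid_def marginal_omit)
next
  case False
  with assms show ?thesis
    by (auto simp: nerve_face_def string_def coarse_groupoid_def marginal_omit fun_eq_iff restrict_def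
      le_Suc_eq)
qed

lemma omit_ctrl: "x \<in> ctrl (Suc m) r \<Longrightarrow> omit (Suc m) i x \<in> ctrl m r"
  by (auto simp: ctrl_def tuples_def omit_def PiE_iff extensional_def)

lemma omit_cultra:
  assumes "W \<in> cultra (Suc m)"
  shows "filtermap (omit (Suc m) i) W \<in> cultra m"
proof -
  obtain r where "eventually (\<lambda>x. x \<in> ctrl (Suc m) r) W"
    using assms by (rule cultraE)
  then have "eventually (\<lambda>x. omit (Suc m) i x \<in> ctrl m r) W"
    by eventually_elim (rule omit_ctrl)
  with cultraD[OF assms] show ?thesis
    by (auto simp: cultra_def ultra_filtermap eventually_filtermap)
qed

lemma omit_eqD:
  assumes "omit n i x = omit n i y" "k \<le> n" "k \<noteq> i" "i \<le> n"
  shows "x k = y k"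
proof -
  \<comment> \<open>The position of entry \<open>k\<close> after entry \<open>i\<close> has been
    deleted.\<close>
  define j where "j = (if k < i then k else k - 1)"
  have "j < n" "(if j < i then j else Suc j) = k"
    using assms(2-4) by (auto simp: j_def)
  then show ?thesis
    using fun_cong[OF assms(1), of j] by (simp add: omit_def)
qed

text \<open>There are at least two vertices, so one other than \<open>i\<close> survives and
  provides the shared coordinate. Only the deleted vertex then needs its colour compared.\<close>

lemma omit_eqI:
  assumes "separating (2 * r) \<kappa>" "x \<in> ctrl (Suc m) r" "y \<in> ctrl (Suc m) r"
    and "omit (Suc m) i x = omit (Suc m) i y" "\<kappa> (x i) = \<kappa> (y i)" "i \<le> Suc m"
  shows "x = y"
proof -
  define k :: nat where "k = (if i = 0 then 1 else 0)"
  have k: "k \<noteq> i" "k \<le> Suc m"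
    by (auto simp: k_def)
  show ?thesis
  proof (rule ctrl_eqI[OF assms(1-3) k(2)])
    show "x k = y k"
      using omit_eqD[OF assms(4)] k assms(6) by blast
    fix j assume "j \<le> Suc m"
    then show "\<kappa> (x j) = \<kappa> (y j)"
      using omit_eqD[OF assms(4), of j] assms(5,6) by (cases "j = i") auto
  qed
qed

text \<open>By \<open>omit_eqI\<close> the colour of the deleted vertex alone cuts the support into
  pieces on which the face map is injective, as the general pushforward lemma requires.\<close>

lemma
  assumes c: "c \<in> uf_chains X d (Suc m)" and i: "i \<le> Suc m"
  shows pushforward_omit_uf:
      "pushforward (tuples X (Suc m)) (omit (Suc m) i) c \<in> uf_chains X d m"
    and ulim_pushforward_omit: "ultra W' \<Longrightarrow>
      (\<Sum>W | ultra W \<and> filtermap (omit (Suc m) i) W = W' \<and> ulim c W \<noteq> 0. ulim c W) =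
      ulim (pushforward (tuples X (Suc m)) (omit (Suc m) i) c) W'"
proof -
  obtain B r where r: "\<And>x. \<bar>c x\<bar> \<le> B" "finite (range c)" "\<And>x. c x \<noteq> 0 \<Longrightarrow> x \<in> ctrl (Suc m) r"
    using uf_chainsD[OF c] by blast
  obtain \<kappa> where \<kappa>: "separating (2 * r) \<kappa>"
    using ex_separating by blast
  have J: "finite (range \<kappa>)"
    using \<kappa> by (simp add: separating_def)
  have inj: "y = y'" if "c y \<noteq> 0" "c y' \<noteq> 0" "\<kappa> (y i) = \<kappa> (y' i)"
      "omit (Suc m) i y = omit (Suc m) i y'" for y y'
    using omit_eqI[OF \<kappa> r(3) r(3)] that i by blast
  have Y: "y \<in> tuples X (Suc m)" if "c y \<noteq> 0" for y
    using r(3)[OF that] by (simp add: ctrl_def)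
  show "(\<Sum>W | ultra W \<and> filtermap (omit (Suc m) i) W = W' \<and> ulim c W \<noteq> 0. ulim c W) =
      ulim (pushforward (tuples X (Suc m)) (omit (Suc m) i) c) W'" if "ultra W'"
    by (rule ulim_pushforward[OF J, of c "\<lambda>y. \<kappa> (y i)", OF rangeI inj Y r(2) that])
  have "\<bar>pushforward (tuples X (Suc m)) (omit (Suc m) i) c z\<bar> \<le> int (card (range \<kappa>)) * B" for z
    by (rule abs_pushforward_le[OF J, of c "\<lambda>y. \<kappa> (y i)", OF rangeI inj Y r(1)])
  moreover have "z \<in> ctrl m r" if "pushforward (tuples X (Suc m)) (omit (Suc m) i) c z \<noteq> 0" for z
  proof -
    have "{y. y \<in> tuples X (Suc m) \<and> omit (Suc m) i y = z \<and> c y \<noteq> 0} \<noteq> {}"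
      using that unfolding pushforward_def by (metis sum.empty)
    then obtain y where "omit (Suc m) i y = z" "c y \<noteq> 0"
      by blast
    then show ?thesis
      using omit_ctrl r(3) by blast
  qed
  ultimately show "pushforward (tuples X (Suc m)) (omit (Suc m) i) c \<in> uf_chains X d m"
    by (intro uf_chainsI) auto
qed

text \<open>Through \<open>string\<close>, the nonzero part of the fibre of a face over
  \<open>string m V\<close> becomes the set of ultrafilters over \<open>V\<close> with nonzero
  limit, where \<open>ulim_pushforward_omit\<close> applies. Outside the nerve both sides
  vanish.\<close>

lemma groupoid_pushforward:
  assumes c: "c \<in> uf_chains X d (Suc m)" and i: "i \<le> Suc m"
  shows "pushforward (topspace (nerve \<G> (Suc m))) (nerve_face \<G> (Suc m) i) (cont_ext (Suc m) c) =
    cont_ext m (pushforward (tuples X (Suc m)) (omit (Suc m) i) c)"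
proof
  fix q
  let ?n = "Suc m"
  let ?F = "{p. p \<in> topspace (nerve \<G> ?n) \<and> nerve_face \<G> ?n i p = q \<and> cont_ext ?n c p \<noteq> 0}"
  have face: "nerve_face \<G> ?n i (string ?n W) = string m (filtermap (omit ?n i) W)" for W
    using i by (rule nerve_face_string)
  show "pushforward (topspace (nerve \<G> ?n)) (nerve_face \<G> ?n i) (cont_ext ?n c) q =
    cont_ext m (pushforward (tuples X ?n) (omit ?n i) c) q"
  proof (cases "q \<in> topspace (nerve \<G> m)")
    case False
    then have "?F = {}"
      using nerve_string string_in_nerve[OF omit_cultra] face by fastforce
    with False show ?thesis
      by (simp add: pushforward_def cont_ext_def)
  next
    case True
    then obtain V where V: "V \<in> cultra m" "q = string m V"
      using nerve_string by blast
    let ?G = "{W. ultra W \<and> filtermap (omit ?n i) W = V \<and> ulim c W \<noteq> 0}"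
    have G: "?G \<subseteq> cultra ?n"
      using ulim_nonzero_cultra[OF c] by blast
    have "?F = string ?n ` ?G"
    proof (intro equalityI subsetI)
      fix p assume p: "p \<in> ?F"
      then obtain W where W: "W \<in> cultra ?n" "p = string ?n W"
        using nerve_string by blast
      then have "string m (filtermap (omit ?n i) W) = string m V"
        using p V face by simp
      then have "filtermap (omit ?n i) W = V"
        using inj_on_string omit_cultra[OF W(1)] V(1) by (metis inj_onD)
      then show "p \<in> string ?n ` ?G"
        using p W cultraD[OF W(1)] by (auto simp: cont_ext_string)
    next
      fix p assume "p \<in> string ?n ` ?G"
      then obtain W where W: "W \<in> ?G" "p = string ?n W"
        by blast
      with G have "W \<in> cultra ?n"
        by blast
      with W show "p \<in> ?F"
        using V face by (simp add: cont_ext_string string_in_nerve)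
    qed
    then have "pushforward (topspace (nerve \<G> ?n)) (nerve_face \<G> ?n i) (cont_ext ?n c) q =
        (\<Sum>p\<in>string ?n ` ?G. cont_ext ?n c p)"
      by (simp add: pushforward_def)
    also have "\<dots> = (\<Sum>W\<in>?G. cont_ext ?n c (string ?n W))"
      using inj_on_subset[OF inj_on_string G] by (simp add: sum.reindex)
    also have "\<dots> = (\<Sum>W\<in>?G. ulim c W)"
      using G by (intro sum.cong refl cont_ext_string) blast
    also have "\<dots> = ulim (pushforward (tuples X ?n) (omit ?n i) c) V"
      using ulim_pushforward_omit[OF c i cultraD[OF V(1)]] .
    finally show ?thesis
      using V by (simp add: cont_ext_string)
  qed
qed

lemma cont_ext_sum:
  assumes "finite I" "\<And>i. i \<in> I \<Longrightarrow> f i \<in> uf_chains X d n"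
  shows "(\<lambda>x. \<Sum>i\<in>I. (-1) ^ i * f i x) \<in> uf_chains X d n \<and>
    cont_ext n (\<lambda>x. \<Sum>i\<in>I. (-1) ^ i * f i x) = (\<lambda>p. \<Sum>i\<in>I. (-1) ^ i * cont_ext n (f i) p)"
  using assms
proof (induction I rule: finite_induct)
  case empty
  then show ?case
    by (simp add: uf_chains_zero cont_ext_zero)
next
  case (insert j I)
  let ?g = "\<lambda>x. \<Sum>i\<in>I. (-1) ^ i * f i x"
  have eq: "(\<lambda>x. \<Sum>i\<in>insert j I. (-1) ^ i * f i x) = (\<lambda>x. ?g x + (-1) ^ j * f j x)"
    using insert.hyps by (simp add: add.commute)
  have g: "?g \<in> uf_chains X d n" "cont_ext n ?g = (\<lambda>p. \<Sum>i\<in>I. (-1) ^ i * cont_ext n (f i) p)"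
    and j: "f j \<in> uf_chains X d n"
    using insert by auto
  show ?case
    unfolding eq using uf_chains_lin[OF g(1) j] cont_ext_lin[OF g(1) j] insert.hyps
    by (simp add: g(2) add.commute fun_eq_iff)
qed

lemma
  assumes c: "c \<in> uf_chains X d (Suc m)"
  shows uf_boundary_uf: "uf_boundary X (Suc m) c \<in> uf_chains X d m"
    and groupoid_boundary_cont_ext:
      "groupoid_boundary \<G> (Suc m) (cont_ext (Suc m) c) = cont_ext m (uf_boundary X (Suc m) c)"
proof -
  let ?f = "\<lambda>i. pushforward (tuples X (Suc m)) (omit (Suc m) i) c"
  have eq: "uf_boundary X (Suc m) c = (\<lambda>x. \<Sum>i\<le>Suc m. (-1) ^ i * ?f i x)"
    by (simp add: uf_boundary_def alternating_pushforward_def fun_eq_iff)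
  note * = cont_ext_sum[of "{..Suc m}" ?f m, OF _ pushforward_omit_uf[OF c]]
  show "uf_boundary X (Suc m) c \<in> uf_chains X d m"
    unfolding eq using * by simp
  show "groupoid_boundary \<G> (Suc m) (cont_ext (Suc m) c) = cont_ext m (uf_boundary X (Suc m) c)"
    unfolding eq using *
    by (simp add: groupoid_boundary_def alternating_pushforward_def groupoid_pushforward[OF c] fun_eq_iff)
qed

text \<open>Every groupoid chain is the extension of its restriction, so the boundary formula for
  extensions covers all of them.\<close>

lemma
  assumes a: "a \<in> Cc_int (nerve \<G> (Suc m))"
  shows groupoid_boundary_Cc_int: "groupoid_boundary \<G> (Suc m) a \<in> Cc_int (nerve \<G> m)"
    and restrict_boundary: "uf_boundary X (Suc m) (restrict_chain X (Suc m) a) =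
      restrict_chain X m (groupoid_boundary \<G> (Suc m) a)"
proof -
  let ?c = "restrict_chain X (Suc m) a"
  have c: "?c \<in> uf_chains X d (Suc m)"
    by (rule restrict_chain_uf[OF a])
  have eq: "groupoid_boundary \<G> (Suc m) a = cont_ext m (uf_boundary X (Suc m) ?c)"
    using groupoid_boundary_cont_ext[OF c] by (simp add: cont_ext_restrict[OF a])
  show "groupoid_boundary \<G> (Suc m) a \<in> Cc_int (nerve \<G> m)"
    unfolding eq by (rule cont_ext_Cc_int[OF uf_boundary_uf[OF c]])
  show "uf_boundary X (Suc m) ?c = restrict_chain X m (groupoid_boundary \<G> (Suc m) a)"
    unfolding eq by (rule restrict_cont_ext[OF uf_boundary_uf[OF c], symmetric])
qed

end

theorem theoremG:
  fixes X :: "'a set" and d :: "'a \<Rightarrow> 'a \<Rightarrow> real"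
  assumes "Metric_space X d" and "bounded_geometry X d"
  shows "\<exists>\<phi>. \<forall>n.
    \<phi> n \<in> iso (groupoid_homology (coarse_groupoid X d) n) (uf_homology X d n) \<and>
    (\<forall>a \<in> cycles (groupoid_complex (coarse_groupoid X d)) (groupoid_boundary (coarse_groupoid X d)) n.
      restrict_chain X n a \<in> cycles (uf_complex X d) (uf_boundary X) n \<and>
      \<phi> n (homology_class (groupoid_complex (coarse_groupoid X d))
              (groupoid_boundary (coarse_groupoid X d)) n a) =
        homology_class (uf_complex X d) (uf_boundary X) n (restrict_chain X n a))"
proof -
  interpret bounded_geometry_space X d
    using assms by (simp add: bounded_geometry_space_def bounded_geometry_space_axioms_def)
  have D: "groupoid_boundary \<G> (Suc n) \<in> carrier (groupoid_complex \<G> (Suc n)) \<rightarrow>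
      carrier (groupoid_complex \<G> n)" for n
    using groupoid_boundary_Cc_int by (auto simp: groupoid_complex_def int_fun_group_def)
  have comm: "uf_boundary X (Suc n) (restrict_chain X (Suc n) a) =
      restrict_chain X n (groupoid_boundary \<G> (Suc n) a)"
    if "a \<in> carrier (groupoid_complex \<G> (Suc n))" for n a
    using restrict_boundary that by (simp add: groupoid_complex_def int_fun_group_def)
  note * = monoid_groupoid_complex monoid_uf_complex restrict_chain_iso D comm
  \<comment> \<open>A homology class is a coset, hence a set of chains, so the induced map is the
    direct image under restriction.\<close>
  show ?thesis
    unfolding groupoid_homology_def uf_homology_def
    using iso_homology[where \<rho> = "restrict_chain X", OF *]
      iso_cycles[where \<rho> = "restrict_chain X", OF *]
      iso_homology_class[where \<rho> = "restrict_chain X", OF *]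
    by (intro exI[of _ "\<lambda>n. (`) (restrict_chain X n)"]) blast
qed

end
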